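(* Let $\tilde{\mathbf{d}}=(d_0,\dots,d_{i-1},\mathbf{d},d_{j+1},\dots,d_L)$, where $\mathbf{d}=(d_i,d_{i+1},\dots,d_j)$ is an architecture such that $\mathcal{V}_{\mathbf{d},r}$ is defective for some $r>0$. Here $i=0$ or $j=L$ is allowed. Suppose $\mathcal{V}_{\tilde{\mathbf{d}},r}$ is not filling. Then $\mathcal{V}_{\tilde{\mathbf{d}},r}$ is defective.
   Context: $\mathrm{Sym}_d(\mathbb{R}^n)$ denotes the real vector space of homogeneous polynomials of degree $d$ in $n$ variables. A polynomial neural network (PNN) with architecture $(\mathbf{d}=(d_0,\dots,d_L),r)$ ($d_i,r$ positive integers) is the map $p_{\mathbf{w}}=W_L\circ\rho_r\circ W_{L-1}\circ\cdots\circ\rho_r\circ W_1:\mathbb{R}^{d_0}\to\mathbb{R}^{d_L}$, where $W_i\in\mathbb{R}^{d_i\times d_{i-1}}$ are linear maps (weights) $\mathbf{w}=(W_1,\dots,W_L)$ and $\rho_r$ raises each coordinate to the $r$-th power. The parameter map is $\Psi_{\mathbf{d},r}:\mathbf{w}\mapsto p_{\mathbf{w}}\in(\mathrm{Sym}_{r^{L-1}}(\mathbb{R}^{d_0}))^{d_L}$. The neurovariety $\mathcal{V}_{\mathbf{d},r}$ is the Zariski closure of the image of $\Psi_{\mathbf{d},r}$ in $(\mathrm{Sym}_{r^{L-1}}(\mathbb{R}^{d_0}))^{d_L}$. It is filling if $\mathcal{V}_{\mathbf{d},r}=(\mathrm{Sym}_{r^{L-1}}(\mathbb{R}^{d_0}))^{d_L}$.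 The expected dimension is $$\mathrm{edim}(\mathcal{V}_{\mathbf{d},r})=\min\Big\{d_L+\sum_{i=0}^{L-1}(d_id_{i+1}-d_{i+1}),\ d_L\binom{d_0+r^{L-1}-1}{r^{L-1}}\Big\}.$$ One always has $\dim(\mathcal{V}_{\mathbf{d},r})\le\mathrm{edim}(\mathcal{V}_{\mathbf{d},r})$; the defect is $\mathrm{edim}(\mathcal{V}_{\mathbf{d},r})-\dim(\mathcal{V}_{\mathbf{d},r})$, and $\mathcal{V}_{\mathbf{d},r}$ is called defective if the defect is nonzero. *)

theory Defs
  imports
    "HOL-Library.Poly_Mapping"
    "HOL-Library.Extended_Nat"
    "HOL-Analysis.Abstract_Topology"
    "Jordan_Normal_Form.Matrix"
begin

section \<open>Real polynomials in indexed variables\<close>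

text \<open>A monomial is a finitely supported exponent vector; the ring structure is the one that
  \<^theory>\<open>HOL-Library.Poly_Mapping\<close> puts on finitely supported coefficient functions (convolution).\<close>

type_synonym 'v mpoly = "('v \<Rightarrow>\<^sub>0 nat) \<Rightarrow>\<^sub>0 real"

definition const_poly :: "real \<Rightarrow> 'v mpoly" where
  "const_poly a = Poly_Mapping.single 0 a"

definition var_poly :: "'v \<Rightarrow> 'v mpoly" where
  "var_poly v = Poly_Mapping.single (Poly_Mapping.single v 1) 1"

definition monom_eval :: "('v \<Rightarrow> real) \<Rightarrow> ('v \<Rightarrow>\<^sub>0 nat) \<Rightarrow> real" where
  "monom_eval x m = (\<Prod>v\<in>Poly_Mapping.keys m. x v ^ Poly_Mapping.lookup m v)"

definition poly_eval :: "('v \<Rightarrow> real) \<Rightarrow> 'v mpoly \<Rightarrow> real" where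
  "poly_eval x p = (\<Sum>m\<in>Poly_Mapping.keys p. Poly_Mapping.lookup p m * monom_eval x m)"

definition monom_degree :: "('v \<Rightarrow>\<^sub>0 nat) \<Rightarrow> nat" where
  "monom_degree m = (\<Sum>v\<in>Poly_Mapping.keys m. Poly_Mapping.lookup m v)"

text \<open>\<open>Sym d n\<close> is $\mathrm{Sym}_d(\mathbb{R}^n)$, in the variables with index \<open>0, \<dots>, n - 1\<close>;
  it contains the zero polynomial.\<close>

definition Sym :: "nat \<Rightarrow> nat \<Rightarrow> nat mpoly set" where
  "Sym d n = {p. \<forall>m\<in>Poly_Mapping.keys p. Poly_Mapping.keys m \<subseteq> {..<n} \<and> monom_degree m = d}"

lemma monom_eval_superset:
  assumes "finite S" "Poly_Mapping.keys m \<subseteq> S"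
  shows "monom_eval x m = (\<Prod>v\<in>S. x v ^ Poly_Mapping.lookup m v)"
  unfolding monom_eval_def
  by (rule prod.mono_neutral_left) (use assms in \<open>auto simp: in_keys_iff\<close>)

lemma monom_eval_zero [simp]: "monom_eval x 0 = 1"
  by (simp add: monom_eval_def)

lemma monom_eval_add: "monom_eval x (m + n) = monom_eval x m * monom_eval x n"
proof -
  let ?S = "Poly_Mapping.keys m \<union> Poly_Mapping.keys n"
  have "finite ?S" "Poly_Mapping.keys (m + n) \<subseteq> ?S"
    by (auto dest: subsetD[OF Poly_Mapping.keys_add])
  then show ?thesis
    by (simp add: monom_eval_superset[of ?S] lookup_add power_add prod.distrib)
qed

lemma poly_eval_superset:
  assumes "finite S" "Poly_Mapping.keys p \<subseteq> S"
  shows "poly_eval x p = (\<Sum>m\<in>S. Poly_Mapping.lookup p m * monom_eval x m)"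
  unfolding poly_eval_def
  by (rule sum.mono_neutral_left) (use assms in \<open>auto simp: in_keys_iff\<close>)

lemma poly_eval_single [simp]: "poly_eval x (Poly_Mapping.single m a) = a * monom_eval x m"
  by (simp add: poly_eval_def)

lemma poly_eval_zero [simp]: "poly_eval x 0 = 0"
  by (simp add: poly_eval_def)

lemma poly_eval_one [simp]: "poly_eval x 1 = 1"
  by (simp add: poly_eval_def)

lemma poly_eval_add: "poly_eval x (p + q) = poly_eval x p + poly_eval x q"
proof -
  let ?S = "Poly_Mapping.keys p \<union> Poly_Mapping.keys q"
  have "finite ?S" "Poly_Mapping.keys (p + q) \<subseteq> ?S"
    by (auto dest: subsetD[OF Poly_Mapping.keys_add])
  then show ?thesis
    by (simp add: poly_eval_superset[of ?S] lookup_add distrib_right sum.distrib)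
qed

lemma poly_eval_sum: "poly_eval x (\<Sum>i\<in>I. f i) = (\<Sum>i\<in>I. poly_eval x (f i))"
  by (induction I rule: infinite_finite_induct) (simp_all add: poly_eval_add)

lemma mpoly_sum_monomials:
  "p = (\<Sum>m\<in>Poly_Mapping.keys p. Poly_Mapping.single m (Poly_Mapping.lookup p m))"
  by (rule poly_mapping_eqI) (simp add: lookup_sum lookup_single when_def in_keys_iff)

lemma poly_eval_mult: "poly_eval x (p * q) = poly_eval x p * poly_eval x q"
proof -
  have "p * q = (\<Sum>m\<in>Poly_Mapping.keys p. \<Sum>n\<in>Poly_Mapping.keys q.
      Poly_Mapping.single (m + n) (Poly_Mapping.lookup p m * Poly_Mapping.lookup q n))"
    by (subst (1) mpoly_sum_monomials[of p], subst (1) mpoly_sum_monomials[of q])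
      (simp add: sum_product mult_single)
  then have "poly_eval x (p * q) = (\<Sum>m\<in>Poly_Mapping.keys p. \<Sum>n\<in>Poly_Mapping.keys q.
      (Poly_Mapping.lookup p m * monom_eval x m) * (Poly_Mapping.lookup q n * monom_eval x n))"
    by (simp add: poly_eval_sum monom_eval_add mult_ac)
  then show ?thesis
    by (simp add: poly_eval_def sum_product)
qed

lemma poly_eval_power: "poly_eval x (p ^ n) = poly_eval x p ^ n"
  by (induction n) (simp_all add: poly_eval_mult)

lemma poly_eval_const [simp]: "poly_eval x (const_poly a) = a"
  by (simp add: const_poly_def)

lemma poly_eval_var [simp]: "poly_eval x (var_poly v) = x v"
  by (simp add: var_poly_def monom_eval_def)

lemma monom_degree_superset:
  assumes "finite S" "Poly_Mapping.keys m \<subseteq> S"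
  shows "monom_degree m = (\<Sum>v\<in>S. Poly_Mapping.lookup m v)"
  unfolding monom_degree_def
  by (rule sum.mono_neutral_left) (use assms in \<open>auto simp: in_keys_iff\<close>)

lemma monom_degree_add: "monom_degree (m + n) = monom_degree m + monom_degree n"
proof -
  let ?S = "Poly_Mapping.keys m \<union> Poly_Mapping.keys n"
  have "finite ?S" "Poly_Mapping.keys (m + n) \<subseteq> ?S"
    by (auto dest: subsetD[OF Poly_Mapping.keys_add])
  then show ?thesis
    by (simp add: monom_degree_superset[of ?S] lookup_add sum.distrib)
qed

lemma Sym_zero: "0 \<in> Sym d n"
  by (simp add: Sym_def)

lemma Sym_const: "const_poly a \<in> Sym 0 n"
  by (simp add: Sym_def const_poly_def monom_degree_def)

lemma Sym_one: "1 \<in> Sym 0 n"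
  by (simp add: Sym_def monom_degree_def)

lemma Sym_var: "v < n \<Longrightarrow> var_poly v \<in> Sym 1 n"
  by (simp add: Sym_def var_poly_def monom_degree_def)

lemma Sym_add: "p \<in> Sym d n \<Longrightarrow> q \<in> Sym d n \<Longrightarrow> p + q \<in> Sym d n"
  unfolding Sym_def using Poly_Mapping.keys_add[of p q] by blast

lemma Sym_sum: "(\<And>i. i \<in> I \<Longrightarrow> f i \<in> Sym d n) \<Longrightarrow> (\<Sum>i\<in>I. f i) \<in> Sym d n"
  by (induction I rule: infinite_finite_induct) (auto simp: Sym_zero intro: Sym_add)

lemma Sym_mult:
  assumes "p \<in> Sym d n" "q \<in> Sym e n"
  shows "p * q \<in> Sym (d + e) n"
  unfolding Sym_def
proof (intro CollectI ballI)
  fix m assume "m \<in> Poly_Mapping.keys (p * q)"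
  then obtain a b where "m = a + b" "a \<in> Poly_Mapping.keys p" "b \<in> Poly_Mapping.keys q"
    using Poly_Mapping.keys_mult[of p q] by blast
  then show "Poly_Mapping.keys m \<subseteq> {..<n} \<and> monom_degree m = d + e"
    using assms Poly_Mapping.keys_add[of a b] by (fastforce simp: Sym_def monom_degree_add)
qed

lemma Sym_power: "p \<in> Sym d n \<Longrightarrow> p ^ k \<in> Sym (d * k) n"
  by (induction k) (auto simp: Sym_one intro: Sym_mult)

section \<open>Zariski topology and Krull dimension\<close>

text \<open>The Zariski topology on \<open>A\<close> with respect to the coordinate functions
  \<open>x \<mapsto> c x i\<close>: the closed sets are the common zero sets in \<open>A\<close> of families of polynomials in the
  coordinates (see \<open>closedin_zariski\<close> below).\<close>

definition zariski :: "'p set \<Rightarrow> ('p \<Rightarrow> 'i \<Rightarrow> real) \<Rightarrow> 'p topology" where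
  "zariski A c = topology (\<lambda>U. \<exists>\<F>. U = {x\<in>A. \<exists>F\<in>\<F>. poly_eval (c x) F \<noteq> 0})"

lemma istopology_zariski:
  "istopology (\<lambda>U. \<exists>\<F>. U = {x\<in>A. \<exists>F\<in>\<F>. poly_eval (c x) F \<noteq> 0})"
  unfolding istopology_def
proof (intro conjI allI impI)
  fix S T
  assume "\<exists>\<F>. S = {x\<in>A. \<exists>F\<in>\<F>. poly_eval (c x) F \<noteq> 0}"
    and "\<exists>\<G>. T = {x\<in>A. \<exists>F\<in>\<G>. poly_eval (c x) F \<noteq> 0}"
  then obtain \<F> \<G> where "S = {x\<in>A. \<exists>F\<in>\<F>. poly_eval (c x) F \<noteq> 0}"
    and "T = {x\<in>A. \<exists>F\<in>\<G>. poly_eval (c x) F \<noteq> 0}" by auto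
  then have "S \<inter> T = {x\<in>A. \<exists>H\<in>(\<lambda>(F, G). F * G) ` (\<F> \<times> \<G>). poly_eval (c x) H \<noteq> 0}"
    by (auto simp: poly_eval_mult)
  then show "\<exists>\<H>. S \<inter> T = {x\<in>A. \<exists>F\<in>\<H>. poly_eval (c x) F \<noteq> 0}" by blast
next
  fix \<K>
  assume "\<forall>K\<in>\<K>. \<exists>\<F>. K = {x\<in>A. \<exists>F\<in>\<F>. poly_eval (c x) F \<noteq> 0}"
  from bchoice[OF this] obtain \<phi>
    where \<phi>: "\<forall>K\<in>\<K>. K = {x\<in>A. \<exists>F\<in>\<phi> K. poly_eval (c x) F \<noteq> 0}" ..
  have *: "x \<in> K \<longleftrightarrow> x \<in> A \<and> (\<exists>F\<in>\<phi> K. poly_eval (c x) F \<noteq> 0)" if "K \<in> \<K>" for x K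
    by (subst bspec[OF \<phi> that]) simp
  have "\<Union>\<K> = {x\<in>A. \<exists>F\<in>\<Union>(\<phi> ` \<K>). poly_eval (c x) F \<noteq> 0}"
    using * by blast
  then show "\<exists>\<H>. \<Union>\<K> = {x\<in>A. \<exists>F\<in>\<H>. poly_eval (c x) F \<noteq> 0}" by blast
qed

lemma openin_zariski:
  "openin (zariski A c) U \<longleftrightarrow> (\<exists>\<F>. U = {x\<in>A. \<exists>F\<in>\<F>. poly_eval (c x) F \<noteq> 0})"
  by (simp add: zariski_def topology_inverse'[OF istopology_zariski])

lemma topspace_zariski [simp]: "topspace (zariski A c) = A"
proof
  show "topspace (zariski A c) \<subseteq> A"
    by (auto simp: topspace_def openin_zariski)
  have "openin (zariski A c) A"
    unfolding openin_zariski by (rule exI[of _ "{1}"]) simp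
  then show "A \<subseteq> topspace (zariski A c)"
    by (rule openin_subset)
qed

lemma closedin_zariski:
  "closedin (zariski A c) Z \<longleftrightarrow> (\<exists>\<F>. Z = {x\<in>A. \<forall>F\<in>\<F>. poly_eval (c x) F = 0})"
proof
  assume "closedin (zariski A c) Z"
  then obtain \<F> where "Z \<subseteq> A" "A - Z = {x\<in>A. \<exists>F\<in>\<F>. poly_eval (c x) F \<noteq> 0}"
    by (auto simp: closedin_def openin_zariski)
  then have "Z = {x\<in>A. \<forall>F\<in>\<F>. poly_eval (c x) F = 0}" by blast
  then show "\<exists>\<F>. Z = {x\<in>A. \<forall>F\<in>\<F>. poly_eval (c x) F = 0}" by blast
next
  assume "\<exists>\<F>. Z = {x\<in>A. \<forall>F\<in>\<F>. poly_eval (c x) F = 0}"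
  then obtain \<F> where "Z = {x\<in>A. \<forall>F\<in>\<F>. poly_eval (c x) F = 0}" by blast
  then have "Z \<subseteq> A" "A - Z = {x\<in>A. \<exists>F\<in>\<F>. poly_eval (c x) F \<noteq> 0}" by blast+
  then show "closedin (zariski A c) Z"
    by (auto simp: closedin_def openin_zariski)
qed

definition irreduciblein :: "'p topology \<Rightarrow> 'p set \<Rightarrow> bool" where
  "irreduciblein X Y \<longleftrightarrow> Y \<subseteq> topspace X \<and> Y \<noteq> {} \<and>
     (\<forall>Z1 Z2. closedin X Z1 \<longrightarrow> closedin X Z2 \<longrightarrow> Y \<subseteq> Z1 \<union> Z2 \<longrightarrow> Y \<subseteq> Z1 \<or> Y \<subseteq> Z2)"

text \<open>The supremum of the lengths \<open>n\<close> of chains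
  \<open>Y\<^sub>0 \<subset> Y\<^sub>1 \<subset> \<dots> \<subset> Y\<^sub>n\<close> of irreducible closed subsets.\<close>

definition krull_dim :: "'p topology \<Rightarrow> enat" where
  "krull_dim X = Sup {enat n | n. \<exists>Y :: nat \<Rightarrow> 'p set.
     (\<forall>i\<le>n. closedin X (Y i) \<and> irreduciblein X (Y i)) \<and> (\<forall>i<n. Y i \<subset> Y (Suc i))}"

section \<open>Polynomial neural networks\<close>

text \<open>An architecture \<open>(d\<^sub>0, \<dots>, d\<^sub>L)\<close> with \<open>L \<ge> 1\<close> is the list of its widths, and weights
  \<open>(W\<^sub>1, \<dots>, W\<^sub>L)\<close> are the list of the matrices, so that \<open>W\<^sub>l\<^sub>+\<^sub>1\<close> is \<open>Ws ! l\<close>.\<close>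

definition architecture :: "nat list \<Rightarrow> bool" where
  "architecture ds \<longleftrightarrow> 2 \<le> length ds \<and> (\<forall>d\<in>set ds. 0 < d)"

definition layers :: "nat list \<Rightarrow> nat" where
  "layers ds = length ds - 1"

definition weights :: "nat list \<Rightarrow> real mat list set" where
  "weights ds = {Ws. length Ws = layers ds \<and>
     (\<forall>l<layers ds. Ws ! l \<in> carrier_mat (ds ! Suc l) (ds ! l))}"

text \<open>The network \<open>W\<^sub>L \<circ> \<rho>\<^sub>r \<circ> \<dots> \<circ> \<rho>\<^sub>r \<circ> W\<^sub>1\<close>. It makes sense over every commutative ring: over the
  reals it is the map \<open>p\<^sub>w\<close>, and applied to the vector of variables over the polynomial ring it gives
  the tuple of polynomials representing that map (\<open>poly_eval_param_map\<close> below).\<close>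

fun pnn :: "nat \<Rightarrow> 'a::comm_ring_1 mat list \<Rightarrow> 'a vec \<Rightarrow> 'a vec" where
  "pnn r [] x = x"
| "pnn r [W] x = W *\<^sub>v x"
| "pnn r (W # V # Ws) x = pnn r (V # Ws) (map_vec (\<lambda>a. a ^ r) (W *\<^sub>v x))"

definition param_map :: "nat list \<Rightarrow> nat \<Rightarrow> real mat list \<Rightarrow> nat mpoly vec" where
  "param_map ds r Ws = pnn r (map (map_mat const_poly) Ws) (vec (hd ds) var_poly)"

text \<open>\<open>(Sym\<^bsub>r^(L-1)\<^esub>(\<real>^d\<^sub>0))^d\<^sub>L\<close>, with the coefficients of the components as coordinates.\<close>

definition ambient :: "nat list \<Rightarrow> nat \<Rightarrow> nat mpoly vec set" where
  "ambient ds r = {q \<in> carrier_vec (last ds).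
     \<forall>k<last ds. q $ k \<in> Sym (r ^ (layers ds - 1)) (hd ds)}"

definition coords :: "nat mpoly vec \<Rightarrow> nat \<times> (nat \<Rightarrow>\<^sub>0 nat) \<Rightarrow> real" where
  "coords q = (\<lambda>(k, m). if k < dim_vec q then Poly_Mapping.lookup (q $ k) m else 0)"

definition neurovariety :: "nat list \<Rightarrow> nat \<Rightarrow> nat mpoly vec set" where
  "neurovariety ds r =
     Abstract_Topology.closure_of (zariski (ambient ds r) coords) (param_map ds r ` weights ds)"

definition filling :: "nat list \<Rightarrow> nat \<Rightarrow> bool" where
  "filling ds r \<longleftrightarrow> neurovariety ds r = ambient ds r"

definition neurodim :: "nat list \<Rightarrow> nat \<Rightarrow> enat" where
  "neurodim ds r = krull_dim (subtopology (zariski (ambient ds r) coords) (neurovariety ds r))"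

text \<open>For positive widths the subtractions on \<open>nat\<close> do not truncate.\<close>

definition edim :: "nat list \<Rightarrow> nat \<Rightarrow> nat" where
  "edim ds r = min
     (last ds + (\<Sum>i<layers ds. ds ! i * ds ! Suc i - ds ! Suc i))
     (last ds * ((hd ds + r ^ (layers ds - 1) - 1) choose (r ^ (layers ds - 1))))"

text \<open>The defect \<open>edim - dim\<close> is nonzero. It is not written as a difference because subtraction
  on \<open>enat\<close> truncates.\<close>

definition defective :: "nat list \<Rightarrow> nat \<Rightarrow> bool" where
  "defective ds r \<longleftrightarrow> neurodim ds r \<noteq> enat (edim ds r)"

lemma poly_eval_mult_mat_vec:
  assumes "W \<in> carrier_mat m n" "p \<in> carrier_vec n"
  shows "map_vec (poly_eval y) (map_mat const_poly W *\<^sub>v p) = W *\<^sub>v map_vec (poly_eval y) p"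
  using assms by (intro eq_vecI)
    (auto simp: scalar_prod_def poly_eval_sum poly_eval_mult intro!: sum.cong)

lemma weights_ConsE:
  assumes "W # Ws \<in> weights ds"
  obtains d0 d1 ds' where "ds = d0 # d1 # ds'" "W \<in> carrier_mat d1 d0" "Ws \<in> weights (d1 # ds')"
proof -
  have len: "length ds = Suc (Suc (length Ws))"
    using assms by (auto simp: weights_def layers_def)
  then obtain d0 d1 ds' where ds: "ds = d0 # d1 # ds'"
    by (metis length_Suc_conv)
  have *: "(W # Ws) ! l \<in> carrier_mat (ds ! Suc l) (ds ! l)" if "l < Suc (length Ws)" for l
    using assms that len by (auto simp: weights_def layers_def)
  have "Ws \<in> weights (d1 # ds')"
    using len ds *[of "Suc _"] by (auto simp: weights_def layers_def)
  with ds *[of 0] show ?thesis by (auto intro: that)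
qed

lemma poly_eval_pnn:
  assumes "Ws \<in> weights ds" "p \<in> carrier_vec (hd ds)"
  shows "map_vec (poly_eval y) (pnn r (map (map_mat const_poly) Ws) p)
    = pnn r Ws (map_vec (poly_eval y) p)"
  using assms
proof (induction r Ws "map_vec (poly_eval y) p" arbitrary: p ds rule: pnn.induct)
  case (1 r)
  then show ?case by simp
next
  case (2 r W)
  from 2(1) obtain d0 d1 ds' where "ds = d0 # d1 # ds'" "W \<in> carrier_mat d1 d0"
    by (rule weights_ConsE)
  with 2(2) show ?case by (simp add: poly_eval_mult_mat_vec)
next
  case (3 r W V Ws)
  from 3(2) obtain d0 d1 ds' where ds: "ds = d0 # d1 # ds'" and W: "W \<in> carrier_mat d1 d0"
    and Ws: "V # Ws \<in> weights (d1 # ds')" by (rule weights_ConsE)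
  let ?q = "map_vec (\<lambda>a. a ^ r) (map_mat const_poly W *\<^sub>v p)"
  have "map_vec (poly_eval y) ?q
      = map_vec (\<lambda>a. a ^ r) (map_vec (poly_eval y) (map_mat const_poly W *\<^sub>v p))"
    by (intro eq_vecI) (simp_all add: poly_eval_power)
  also have "\<dots> = map_vec (\<lambda>a. a ^ r) (W *\<^sub>v map_vec (poly_eval y) p)"
    using W 3(3) ds by (simp add: poly_eval_mult_mat_vec)
  finally have q: "map_vec (\<lambda>a. a ^ r) (W *\<^sub>v map_vec (poly_eval y) p) = map_vec (poly_eval y) ?q" ..
  have "?q \<in> carrier_vec d1" using W by (auto intro!: carrier_vecI)
  with 3(1)[OF q Ws] q show ?case by simp
qed

lemma poly_eval_param_map:
  assumes "Ws \<in> weights ds" "x \<in> carrier_vec (hd ds)"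
  shows "map_vec (poly_eval (\<lambda>i. x $ i)) (param_map ds r Ws) = pnn r Ws x"
proof -
  have "map_vec (poly_eval (\<lambda>i. x $ i)) (vec (hd ds) var_poly) = x"
    using assms(2) by (intro eq_vecI) auto
  then show ?thesis
    using poly_eval_pnn[OF assms(1), of "vec (hd ds) var_poly"] by (simp add: param_map_def)
qed

lemma Sym_mult_mat_vec:
  assumes "W \<in> carrier_mat m k" "p \<in> carrier_vec k" "\<And>i. i < k \<Longrightarrow> p $ i \<in> Sym d n" "i < m"
  shows "(map_mat const_poly W *\<^sub>v p) $ i \<in> Sym d n"
proof -
  have "const_poly a * q \<in> Sym d n" if "q \<in> Sym d n" for a q
    using Sym_mult[OF Sym_const that] by simp
  then show ?thesis
    using assms by (auto simp: scalar_prod_def intro!: Sym_sum)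
qed

lemma pnn_Sym:
  assumes "Ws \<in> weights ds" "Ws \<noteq> []" "p \<in> carrier_vec (hd ds)"
    "\<And>i. i < hd ds \<Longrightarrow> p $ i \<in> Sym d n"
  shows "pnn r (map (map_mat const_poly) Ws) p \<in> carrier_vec (last ds) \<and>
    (\<forall>k<last ds. pnn r (map (map_mat const_poly) Ws) p $ k \<in> Sym (d * r ^ (length Ws - 1)) n)"
  using assms
proof (induction Ws arbitrary: p ds d)
  case Nil
  then show ?case by simp
next
  case (Cons W Ws)
  from Cons(2) obtain d0 d1 ds' where ds: "ds = d0 # d1 # ds'" and W: "W \<in> carrier_mat d1 d0"
    and Ws: "Ws \<in> weights (d1 # ds')" by (rule weights_ConsE)
  have S: "(map_mat const_poly W *\<^sub>v p) $ i \<in> Sym d n" if "i < d1" for i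
    using Sym_mult_mat_vec[OF W _ _ that] Cons(4,5) ds by simp
  show ?case
  proof (cases Ws)
    case Nil
    then have "ds' = []" using Ws by (auto simp: weights_def layers_def)
    with Nil ds S W show ?thesis by (auto intro!: carrier_vecI)
  next
    case (Cons V Vs)
    let ?q = "map_vec (\<lambda>a. a ^ r) (map_mat const_poly W *\<^sub>v p)"
    have "?q \<in> carrier_vec d1" using W by (auto intro!: carrier_vecI)
    moreover have "?q $ i \<in> Sym (d * r) n" if "i < d1" for i
      using Sym_power[OF S[OF that], of r] that W by simp
    ultimately show ?thesis
      using Cons.IH[OF Ws, of ?q "d * r"] Cons ds by (simp add: mult.assoc)
  qed
qed

lemma param_map_in_ambient:
  assumes "architecture ds" "Ws \<in> weights ds"
  shows "param_map ds r Ws \<in> ambient ds r"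
proof -
  have "Ws \<noteq> []" "length Ws = layers ds"
    using assms by (auto simp: architecture_def weights_def layers_def)
  then show ?thesis
    using pnn_Sym[OF assms(2), of "vec (hd ds) var_poly" 1 "hd ds" r] Sym_var
    by (auto simp: ambient_def param_map_def)
qed

end

theory Submission
  imports Defs "HOL-Analysis.Continuum_Not_Denumerable" "HOL-Computational_Algebra.Polynomial"
begin

text \<open>Dimension is measured by a Hilbert function. A set of points is determining in degree \<open>D\<close> if
  every polynomial of degree at most \<open>D\<close> in the given generators that vanishes there vanishes
  everywhere, and growth of order \<open>s\<close> means that there are determining sets of size \<open>O(D\<^sup>s)\<close>.
  A chain of irreducible closed sets of length \<open>n\<close> gives \<open>n\<close> algebraically independent functions, so
  \<open>n \<le> s\<close>. Conversely, restricting a polynomial parametrisation to a hyperplane \<open>x\<^sub>j = t\<close> lowers the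
  order by at most one for some \<open>t\<close>, so slicing repeatedly gives a chain whose length is
  the least order \<open>s\<close>. Hence a defective architecture has growth of an order less than its expected
  number of parameters. Adding a layer at either end multiplies determining sets by a grid in the new
  weights, normalised by rescaling the new hidden neurons, and so raises the order by at most
  the increase in the expected number of parameters. The order thus stays below this number, and
  not being filling keeps the dimension below that of the irreducible ambient space.\<close>

section \<open>Polynomial functions of bounded degree\<close>

text \<open>The two architectures need opposite inequalities. For the inner one the dimension must
  be bounded below by an order of growth, which the chains obtained by slicing provide; for the
  extended one any order of growth bounds the dimension above, by counting independent functions
  against determining points. No information on fibres or on ranks of derivatives enters. For
  positive widths the expected number of parameters is the number of weights minus the number of
  hidden neurons: scaling the incoming weights of a hidden neuron by \<open>c > 0\<close> and its
  outgoing weights by \<open>c^(-r)\<close> does not change the network. A grid in all new weights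
  would lose one unit per new hidden neuron, so the normalisation is what makes the two increases
  agree exactly. The obstacle in slicing is the constant hidden in an order of growth, which may
  vary with the slice. The constants are natural numbers and the slices are indexed by reals, so
  uncountability yields infinitely many slices with a common constant. Values serve better than
  coefficients as generators because a value of a network with a prepended layer is a value of the
  old network at another point.\<close>

inductive polyfun :: "'w set \<Rightarrow> ('w \<Rightarrow> real) set \<Rightarrow> nat \<Rightarrow> ('w \<Rightarrow> real) \<Rightarrow> bool"
  for X G where
  polyfun_const: "polyfun X G D (\<lambda>_. a)"
| polyfun_gen: "g \<in> G \<Longrightarrow> 1 \<le> D \<Longrightarrow> polyfun X G D g"
| polyfun_add: "polyfun X G D f \<Longrightarrow> polyfun X G D g \<Longrightarrow> polyfun X G D (\<lambda>x. f x + g x)"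
| polyfun_mult_le: "polyfun X G D f \<Longrightarrow> polyfun X G E g \<Longrightarrow> D + E \<le> D' \<Longrightarrow>
    polyfun X G D' (\<lambda>x. f x * g x)"
| polyfun_cong: "polyfun X G D f \<Longrightarrow> (\<And>x. x \<in> X \<Longrightarrow> f x = g x) \<Longrightarrow> polyfun X G D g"

lemma polyfun_mult:
  "polyfun X G D f \<Longrightarrow> polyfun X G E g \<Longrightarrow> polyfun X G (D + E) (\<lambda>x. f x * g x)"
  by (rule polyfun_mult_le[OF _ _ order_refl])

lemma polyfun_mono:
  assumes "polyfun X G D f" "D \<le> E"
  shows "polyfun X G E f"
  using polyfun_mult_le[OF assms(1) polyfun_const[of X G 0 1], of E] assms(2) by simp

lemma polyfun_scale: "polyfun X G D f \<Longrightarrow> polyfun X G D (\<lambda>x. a * f x)"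
  using polyfun_mult_le[OF polyfun_const[of X G 0 a], of D f D] by simp

lemma polyfun_sum:
  "(\<And>i. i \<in> I \<Longrightarrow> polyfun X G D (f i)) \<Longrightarrow> polyfun X G D (\<lambda>x. \<Sum>i\<in>I. f i x)"
  by (induction I rule: infinite_finite_induct) (auto intro: polyfun_const polyfun_add)

lemma polyfun_power: "polyfun X G D f \<Longrightarrow> polyfun X G (D * n) (\<lambda>x. f x ^ n)"
  by (induction n) (auto intro: polyfun_const polyfun_mult)

text \<open>Substitution, restriction to a subset (with \<open>\<phi>\<close> the identity) and
  change of generators all go through this lemma. Since \<open>polyfun\<close> describes functions
  and not formal expressions, relations between generators never have to be tracked.\<close>

lemma polyfun_comp:
  assumes "polyfun X G D f" "\<And>y. y \<in> Y \<Longrightarrow> \<phi> y \<in> X"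
    and "\<And>g. g \<in> G \<Longrightarrow> polyfun Y H e (\<lambda>y. g (\<phi> y))"
  shows "polyfun Y H (D * e) (\<lambda>y. f (\<phi> y))"
  using assms(1)
proof induction
  case (polyfun_gen g D)
  then have "e \<le> D * e" by simp
  with assms(3)[OF polyfun_gen(1)] show ?case by (rule polyfun_mono)
next
  case (polyfun_mult_le D f E g D')
  then have "D * e + E * e \<le> D' * e"
    by (metis add_mult_distrib mult_le_mono1)
  with polyfun_mult_le(4,5) show ?case by (rule polyfun.polyfun_mult_le)
next
  case (polyfun_cong D f g)
  show ?case
    by (rule polyfun.polyfun_cong[OF polyfun_cong(3)]) (use polyfun_cong(2) assms(2) in auto)
qed (auto intro: polyfun.intros)

lemma polyfun_eq_on_gens:
  assumes "polyfun X G D f" "x \<in> X" "y \<in> X" "\<And>g. g \<in> G \<Longrightarrow> g x = g y"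
  shows "f x = f y"
  using assms(1) by induction (use assms(2-4) in auto)

definition coord_funs :: "('w \<Rightarrow> 'i \<Rightarrow> real) \<Rightarrow> ('w \<Rightarrow> real) set" where
  "coord_funs c = range (\<lambda>i x. c x i)"

lemma coord_funs_in: "(\<lambda>x. c x i) \<in> coord_funs c"
  by (auto simp: coord_funs_def)

lemma polyfun_coord: "polyfun X (coord_funs c) 1 (\<lambda>x. c x i)"
  by (rule polyfun_gen) (simp_all add: coord_funs_in)

lemma polyfun_imp_mpoly:
  assumes "polyfun X (coord_funs c) D f"
  shows "\<exists>F. \<forall>x\<in>X. f x = poly_eval (c x) F"
  using assms
proof induction
  case (polyfun_const D a)
  show ?case by (rule exI[of _ "const_poly a"]) simp
next
  case (polyfun_gen g D)
  then obtain i where "g = (\<lambda>x. c x i)" by (auto simp: coord_funs_def)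
  then show ?case by (intro exI[of _ "var_poly i"]) simp
next
  case (polyfun_add D f g)
  then obtain F G where "\<forall>x\<in>X. f x = poly_eval (c x) F" "\<forall>x\<in>X. g x = poly_eval (c x) G" by auto
  then show ?case by (intro exI[of _ "F + G"]) (simp add: poly_eval_add)
next
  case (polyfun_mult_le D f E g D')
  then obtain F G where "\<forall>x\<in>X. f x = poly_eval (c x) F" "\<forall>x\<in>X. g x = poly_eval (c x) G" by auto
  then show ?case by (intro exI[of _ "F * G"]) (simp add: poly_eval_mult)
next
  case (polyfun_cong D f g)
  then show ?case by auto
qed

lemma polyfun_poly_eval: "\<exists>D. polyfun X (coord_funs c) D (\<lambda>x. poly_eval (c x) F)"
proof -
  have pr: "\<exists>D. polyfun X (coord_funs c) D (\<lambda>x. \<Prod>v\<in>S. c x v ^ k v)" if "finite S" for S k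
    using that
  proof induction
    case empty
    show ?case by (auto intro: polyfun_const)
  next
    case (insert v S)
    then obtain D where "polyfun X (coord_funs c) D (\<lambda>x. \<Prod>v\<in>S. c x v ^ k v)" by auto
    from polyfun_mult[OF polyfun_power[OF polyfun_coord] this] insert(1,2) show ?case by auto
  qed
  have su: "\<exists>D. polyfun X (coord_funs c) D (\<lambda>x. \<Sum>m\<in>S. a m * monom_eval (c x) m)"
    if "finite S" for S and a :: "_ \<Rightarrow> real"
    using that
  proof induction
    case empty
    show ?case by (auto intro: polyfun_const)
  next
    case (insert m S)
    then obtain D where D: "polyfun X (coord_funs c) D (\<lambda>x. \<Sum>m\<in>S. a m * monom_eval (c x) m)"
      by auto
    obtain E where E: "polyfun X (coord_funs c) E (\<lambda>x. monom_eval (c x) m)"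
      using pr[OF finite_keys] unfolding monom_eval_def by blast
    have "polyfun X (coord_funs c) (max D E)
        (\<lambda>x. a m * monom_eval (c x) m + (\<Sum>m\<in>S. a m * monom_eval (c x) m))"
      by (intro polyfun_add polyfun_scale polyfun_mono[OF D] polyfun_mono[OF E]) auto
    with insert show ?case by auto
  qed
  show ?thesis unfolding poly_eval_def by (rule su) simp
qed

abbreviation vars :: "(('j \<Rightarrow> real) \<Rightarrow> real) set" where
  "vars \<equiv> coord_funs (\<lambda>x. x)"

lemma polyfun_vars: "polyfun X vars 1 (\<lambda>x. x j)"
  using polyfun_coord[of X "\<lambda>x. x"] .

lemma polyfun_real_imp_poly:
  assumes "polyfun UNIV {\<lambda>t. t} D f"
  shows "\<exists>p. degree p \<le> D \<and> (\<forall>t. f t = poly p t)"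
  using assms
proof induction
  case (polyfun_const D a)
  show ?case by (rule exI[of _ "[:a:]"]) simp
next
  case (polyfun_gen g D)
  then show ?case by (intro exI[of _ "[:0, 1:]"]) simp
next
  case (polyfun_add D f g)
  then obtain p q where "degree p \<le> D" "\<forall>t. f t = poly p t" "degree q \<le> D" "\<forall>t. g t = poly q t"
    by auto
  then show ?case by (intro exI[of _ "p + q"]) (simp add: degree_add_le)
next
  case (polyfun_mult_le D f E g D')
  then obtain p q where "degree p \<le> D" "\<forall>t. f t = poly p t" "degree q \<le> E" "\<forall>t. g t = poly q t"
    by auto
  moreover have "degree (p * q) \<le> D'"
    using degree_mult_le[of p q] calculation polyfun_mult_le(3) by linarith
  ultimately show ?case by (intro exI[of _ "p * q"]) simp
next
  case (polyfun_cong D f g)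
  then show ?case by auto
qed

text \<open>Reduces questions in many variables to univariate polynomials, which have no zero
  divisors and, if nonzero, finitely many roots. This serves slices, the positive orthant and the
  irreducibility of images.\<close>

lemma polyfun_line:
  assumes "polyfun UNIV vars D f"
  shows "\<exists>p. degree p \<le> D \<and> (\<forall>t. f (\<lambda>j. a j + t * b j) = poly p t)"
proof -
  have "polyfun UNIV {\<lambda>t. t} 1 (\<lambda>t. g (\<lambda>j. a j + t * b j))" if "g \<in> vars" for g
  proof -
    from that obtain j where g: "g = (\<lambda>x. x j)" by (auto simp: coord_funs_def)
    have "polyfun UNIV {\<lambda>t. t} 1 (\<lambda>t. a j + b j * t)"
      by (intro polyfun_add polyfun_const polyfun_scale polyfun_gen) simp_all
    then show ?thesis unfolding g by (simp add: mult.commute)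
  qed
  from polyfun_comp[OF assms _ this]
  have "polyfun UNIV {\<lambda>t. t} D (\<lambda>t. f (\<lambda>j. a j + t * b j))" by simp
  then show ?thesis by (rule polyfun_real_imp_poly)
qed

lemma polyfun_slices:
  fixes x :: "'j \<Rightarrow> real"
  assumes "polyfun UNIV vars D f" "finite E" "D < card E" "\<And>t. t \<in> E \<Longrightarrow> f (x(j := t)) = 0"
  shows "f x = 0"
proof -
  obtain p where p: "degree p \<le> D"
    and fp: "\<And>t. f (\<lambda>i. (x(j := 0)) i + t * (if i = j then 1 else 0)) = poly p t"
    using polyfun_line[OF assms(1), of "x(j := 0)" "\<lambda>i. if i = j then 1 else 0"] by blast
  have *: "(\<lambda>i. (x(j := 0)) i + t * (if i = j then 1 else 0)) = x(j := t)" for t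
    by auto
  have "p = 0"
  proof (rule ccontr)
    assume "p \<noteq> 0"
    have "E \<subseteq> {t. poly p t = 0}" using assms(4) fp * by auto
    then have "card E \<le> card {t. poly p t = 0}"
      by (rule card_mono[OF poly_roots_finite[OF \<open>p \<noteq> 0\<close>]])
    also have "\<dots> \<le> degree p" by (rule card_poly_roots_bound) fact
    finally show False using p assms(3) by simp
  qed
  then have "f (x(j := x j)) = 0" using fp[of "x j"] * by (simp del: fun_upd_triv)
  then show ?thesis by simp
qed

section \<open>Determining sets and their growth\<close>

text \<open>If the space of these functions on \<open>X\<close> is finite-dimensional, its dimension
  is the least size of such a set: the value of a Hilbert function at \<open>D\<close>. Points are
  easier to transport than bases, since they pass along maps and products.\<close>

definition determining :: "'w set \<Rightarrow> ('w \<Rightarrow> real) set \<Rightarrow> nat \<Rightarrow> 'w set \<Rightarrow> bool" where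
  "determining X G D Z \<longleftrightarrow> Z \<subseteq> X \<and> finite Z \<and>
     (\<forall>f. polyfun X G D f \<longrightarrow> (\<forall>z\<in>Z. f z = 0) \<longrightarrow> (\<forall>x\<in>X. f x = 0))"

text \<open>An upper bound only, so larger orders qualify too. \<open>Suc D\<close> in place of
  \<open>D\<close> keeps the bound from being 0 at \<open>D = 0\<close>.\<close>

definition growth :: "'w set \<Rightarrow> ('w \<Rightarrow> real) set \<Rightarrow> nat \<Rightarrow> bool" where
  "growth X G s \<longleftrightarrow> (\<exists>C. \<forall>D. \<exists>Z. determining X G D Z \<and> card Z \<le> C * Suc D ^ s)"

lemma growth_mono:
  assumes "growth X G s" "s \<le> t"
  shows "growth X G t"
proof -
  have "C * Suc D ^ s \<le> C * Suc D ^ t" for C D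
    using assms(2) by (intro mult_le_mono2 power_increasing) auto
  with assms(1) show ?thesis unfolding growth_def by (meson order_trans)
qed

text \<open>The image of a determining set is determining: a function of degree \<open>D\<close> on
  \<open>Y\<close> pulls back to degree \<open>D * e\<close> on \<open>X\<close>, and the factor
  \<open>e\<close> only affects the constant.\<close>

lemma growth_comp:
  assumes "growth X G s" "\<phi> ` X = Y"
    and "\<And>h. h \<in> H \<Longrightarrow> polyfun X G e (\<lambda>x. h (\<phi> x))"
  shows "growth Y H s"
proof -
  obtain C where C: "\<And>D. \<exists>Z. determining X G D Z \<and> card Z \<le> C * Suc D ^ s"
    using assms(1) by (auto simp: growth_def)
  show ?thesis unfolding growth_def
  proof (rule exI, rule allI)
    fix D
    obtain Z where Z: "determining X G (D * e) Z" "card Z \<le> C * Suc (D * e) ^ s"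
      using C by blast
    have "determining Y H D (\<phi> ` Z)"
      unfolding determining_def
    proof (intro conjI allI impI)
      fix f assume f: "polyfun Y H D f" "\<forall>z\<in>\<phi> ` Z. f z = 0"
      have "polyfun X G (D * e) (\<lambda>x. f (\<phi> x))"
        by (rule polyfun_comp[OF f(1) _ assms(3)]) (use assms(2) in auto)
      then have "\<forall>x\<in>X. f (\<phi> x) = 0" using Z(1) f(2) by (auto simp: determining_def)
      then show "\<forall>y\<in>Y. f y = 0" using assms(2) by auto
    qed (use Z(1) assms(2) in \<open>auto simp: determining_def\<close>)
    moreover have "card (\<phi> ` Z) \<le> (C * Suc e ^ s) * Suc D ^ s"
    proof -
      have "finite Z" using Z(1) by (simp add: determining_def)
      then have "card (\<phi> ` Z) \<le> C * Suc (D * e) ^ s"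
        using Z(2) card_image_le[of Z \<phi>] by linarith
      also have "\<dots> \<le> C * (Suc e * Suc D) ^ s"
        by (intro mult_le_mono2 power_mono) auto
      finally show ?thesis by (simp only: power_mult_distrib mult.assoc)
    qed
    ultimately show "\<exists>Z. determining Y H D Z \<and> card Z \<le> (C * Suc e ^ s) * Suc D ^ s" by blast
  qed
qed

text \<open>An affine coordinate subspace kept inside the full function space, so that inductions
  over \<open>J\<close> lower its dimension without changing the type.\<close>

definition slab :: "'j set \<Rightarrow> ('j \<Rightarrow> real) \<Rightarrow> ('j \<Rightarrow> real) set" where
  "slab J \<gamma> = {x. \<forall>j. j \<notin> J \<longrightarrow> x j = \<gamma> j}"

lemma slab_upd: "x \<in> slab (insert j J) \<gamma> \<Longrightarrow> j \<notin> J \<Longrightarrow> x(j := t) \<in> slab J (\<gamma>(j := t))"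
  by (auto simp: slab_def)

lemma slab_subset: "slab J (\<gamma>(j := t)) \<subseteq> slab (insert j J) \<gamma>"
  by (auto simp: slab_def)

text \<open>The points are an integer grid with \<open>D + 1\<close> values per direction in
  \<open>J\<close>; by \<open>polyfun_slices\<close>, that many parallel hyperplanes suffice at each
  step.\<close>

lemma grid:
  assumes "finite J"
  shows "\<exists>Z \<subseteq> slab J \<gamma>. finite Z \<and> card Z \<le> Suc D ^ card J \<and>
    (\<forall>f. polyfun UNIV vars D f \<longrightarrow> (\<forall>z\<in>Z. f z = 0) \<longrightarrow> (\<forall>x\<in>slab J \<gamma>. f x = 0))"
  using assms
proof (induction J arbitrary: \<gamma>)
  case empty
  show ?case by (rule exI[of _ "{\<gamma>}"]) (auto simp: slab_def fun_eq_iff)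
next
  case (insert j J)
  from insert.IH[of "\<gamma>(j := real l)" for l] obtain Z where
    Z: "Z l \<subseteq> slab J (\<gamma>(j := real l))" "finite (Z l)" "card (Z l) \<le> Suc D ^ card J"
      "\<And>f. polyfun UNIV vars D f \<Longrightarrow> \<forall>z\<in>Z l. f z = 0 \<Longrightarrow> \<forall>x\<in>slab J (\<gamma>(j := real l)). f x = 0"
    for l by metis
  show ?case
  proof (intro exI conjI allI impI ballI)
    show "(\<Union>l\<in>{..D}. Z l) \<subseteq> slab (insert j J) \<gamma>"
      using Z(1) slab_subset by fastforce
    show "finite (\<Union>l\<in>{..D}. Z l)" using Z(2) by auto
    have "card (\<Union>l\<in>{..D}. Z l) \<le> (\<Sum>l\<in>{..D}. card (Z l))" by (rule card_UN_le) simp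
    also have "\<dots> \<le> (\<Sum>l\<in>{..D}. Suc D ^ card J)" by (rule sum_mono) (rule Z(3))
    finally show "card (\<Union>l\<in>{..D}. Z l) \<le> Suc D ^ card (insert j J)" using insert by simp
  next
    fix f and x :: "'a \<Rightarrow> real"
    assume f: "polyfun UNIV vars D f" "\<forall>z\<in>\<Union>l\<in>{..D}. Z l. f z = 0"
      and x: "x \<in> slab (insert j J) \<gamma>"
    show "f x = 0"
    proof (rule polyfun_slices[OF f(1)])
      show "finite (real ` {..D})" by simp
      show "D < card (real ` {..D})" by (simp add: card_image)
      fix t assume "t \<in> real ` {..D}"
      then obtain l where "l \<le> D" "t = real l" by auto
      then show "f (x(j := t)) = 0"
        using Z(4)[OF f(1), of l] f(2) slab_upd[OF x insert(2)] by auto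
    qed
  qed
qed

text \<open>The parameters indexed by \<open>N\<close> are normalised by a group action under which the generators
  are invariant; the positive orthant is Zariski dense, so it is enough to normalise there.\<close>

lemma growth_join:
  fixes join :: "('j \<Rightarrow> real) \<Rightarrow> 'u \<Rightarrow> 'w"
  assumes gr: "growth X G s" and J: "finite J" and N: "finite N"
    and Y: "Y = {join x u | x u. u \<in> X}"
    and lin: "\<And>x h. h \<in> H \<Longrightarrow> polyfun X G e (\<lambda>u. h (join x u))"
    and par: "\<And>u h. u \<in> X \<Longrightarrow> h \<in> H \<Longrightarrow> polyfun UNIV vars e' (\<lambda>x. h (join x u))"
    and norm: "\<And>x u. u \<in> X \<Longrightarrow> (\<And>j. j \<in> N \<Longrightarrow> 0 < x j) \<Longrightarrow>
      \<exists>x'\<in>slab J \<gamma>. \<exists>u'\<in>X. \<forall>h\<in>H. h (join x u) = h (join x' u')"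
  shows "growth Y H (s + card J)"
proof -
  obtain C where C: "\<And>D. \<exists>Z. determining X G D Z \<and> card Z \<le> C * Suc D ^ s"
    using gr by (auto simp: growth_def)
  have inY: "join x u \<in> Y" if "u \<in> X" for x u using that Y by auto
  show ?thesis unfolding growth_def
  proof (rule exI, rule allI)
    fix D
    obtain Z where Z: "determining X G (D * e) Z" "card Z \<le> C * Suc (D * e) ^ s"
      using C by blast
    obtain T where T: "T \<subseteq> slab J \<gamma>" "finite T" "card T \<le> Suc (D * e') ^ card J"
      "\<And>f. polyfun UNIV vars (D * e') f \<Longrightarrow> \<forall>z\<in>T. f z = 0 \<Longrightarrow> \<forall>x\<in>slab J \<gamma>. f x = 0"
      using grid[OF J, of \<gamma> "D * e'"] by blast
    \<comment> \<open>Normalised grid points times determining points of \<open>X\<close>. A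
      function of degree \<open>D\<close> on \<open>Y\<close> has degree \<open>D * e\<close> in the
      generators of \<open>X\<close> for fixed \<open>x\<close>, and degree \<open>D * e'\<close> in
      \<open>x\<close> for fixed \<open>u\<close>; this dictates the degrees chosen for
      \<open>Z\<close> and \<open>T\<close>.\<close>
    let ?Z = "(\<lambda>(x, u). join x u) ` (T \<times> Z)"
    have "determining Y H D ?Z"
      unfolding determining_def
    proof (intro conjI allI impI)
      show "?Z \<subseteq> Y" "finite ?Z" using Z(1) T(2) inY by (auto simp: determining_def)
      fix f assume f: "polyfun Y H D f" "\<forall>z\<in>?Z. f z = 0"
      have f1: "polyfun X G (D * e) (\<lambda>u. f (join x u))" for x
        by (rule polyfun_comp[where \<phi> = "join x", OF f(1)]) (use inY lin in auto)
      have f2: "polyfun UNIV vars (D * e') (\<lambda>x. f (join x u))" if "u \<in> X" for u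
        by (rule polyfun_comp[where \<phi> = "\<lambda>x. join x u", OF f(1)]) (use inY par that in auto)
      have "f (join x u) = 0" if "x \<in> T" "u \<in> X" for x u
        using Z(1) f1[of x] f(2) that by (auto simp: determining_def)
      then have sl: "f (join x u) = 0" if "x \<in> slab J \<gamma>" "u \<in> X" for x u
        using T(4)[OF f2] that by blast
      have pos: "f (join x u) = 0" if u: "u \<in> X" and x: "\<And>j. j \<in> N \<Longrightarrow> 0 < x j" for x u
      proof -
        obtain x' u' where "x' \<in> slab J \<gamma>" "u' \<in> X" "\<forall>h\<in>H. h (join x u) = h (join x' u')"
          using norm[of u x] u x by blast
        then show ?thesis
          using polyfun_eq_on_gens[OF f(1) inY[OF u] inY] sl by metis
      qed
      \<comment> \<open>Moving far enough along the all-ones direction makes the coordinates in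
        \<open>N\<close> positive. The polynomial on this line therefore has infinitely many roots
        and vanishes at \<open>t = 0\<close> as well.\<close>
      have "f (join x u) = 0" if u: "u \<in> X" for x u
      proof -
        obtain p where p: "\<And>t. f (join (\<lambda>j. x j + t * 1) u) = poly p t"
          using polyfun_line[OF f2[OF u], of x "\<lambda>_. 1"] by blast
        define t0 where "t0 = (\<Sum>j\<in>N. \<bar>x j\<bar>)"
        have "poly p t = 0" if "t > t0" for t
        proof -
          have "0 < x j + t * 1" if "j \<in> N" for j
            using member_le_sum[of j N "\<lambda>j. \<bar>x j\<bar>"] that N \<open>t > t0\<close> unfolding t0_def by auto
          from pos[OF u this] show ?thesis using p[of t] by simp
        qed
        then have "{t0<..} \<subseteq> {t. poly p t = 0}" by auto
        then have "infinite {t. poly p t = 0}"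
          using infinite_Ioi[of t0] finite_subset by blast
        then have "p = 0" using poly_roots_finite by blast
        then show ?thesis using p[of 0] by simp
      qed
      then show "\<forall>y\<in>Y. f y = 0" using Y by auto
    qed
    moreover have "card ?Z \<le> (Suc e' ^ card J * C * Suc e ^ s) * Suc D ^ (s + card J)"
    proof -
      have fZ: "finite Z" using Z(1) by (simp add: determining_def)
      have "card ?Z \<le> card T * card Z"
        using card_image_le[of "T \<times> Z"] T(2) fZ by (simp add: card_cartesian_product)
      also have "\<dots> \<le> Suc (D * e') ^ card J * (C * Suc (D * e) ^ s)"
        by (rule mult_le_mono[OF T(3) Z(2)])
      also have "\<dots> \<le> (Suc e' * Suc D) ^ card J * (C * (Suc e * Suc D) ^ s)"
        by (intro mult_le_mono power_mono order_refl) auto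
      finally show ?thesis by (simp only: power_mult_distrib power_add mult_ac)
    qed
    ultimately show "\<exists>Z. determining Y H D Z \<and>
        card Z \<le> (Suc e' ^ card J * C * Suc e ^ s) * Suc D ^ (s + card J)" by blast
  qed
qed

lemma growth_singleton: "growth {x} G 0"
  unfolding growth_def determining_def by (intro exI[of _ 1] allI exI[of _ "{x}"]) auto

section \<open>Chains of irreducible closed sets\<close>

abbreviation zclosure :: "'p set \<Rightarrow> ('p \<Rightarrow> 'i \<Rightarrow> real) \<Rightarrow> 'p set \<Rightarrow> 'p set" where
  "zclosure A c S \<equiv> Abstract_Topology.closure_of (zariski A c) S"

lemma in_zclosure_iff:
  assumes "S \<subseteq> A"
  shows "y \<in> zclosure A c S \<longleftrightarrow>
    y \<in> A \<and> (\<forall>F. (\<forall>x\<in>S. poly_eval (c x) F = 0) \<longrightarrow> poly_eval (c y) F = 0)" (is "_ \<longleftrightarrow> ?R y")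
proof
  assume y: "y \<in> zclosure A c S"
  have yA: "y \<in> A" using y closure_of_subset_topspace[of "zariski A c" S] by auto
  moreover have "poly_eval (c y) F = 0" if F: "\<forall>x\<in>S. poly_eval (c x) F = 0" for F
  proof -
    have "closedin (zariski A c) {x\<in>A. \<forall>G\<in>{F}. poly_eval (c x) G = 0}"
      unfolding closedin_zariski by blast
    moreover have "S \<subseteq> {x\<in>A. \<forall>G\<in>{F}. poly_eval (c x) G = 0}" using assms F by auto
    ultimately have "zclosure A c S \<subseteq> {x\<in>A. \<forall>G\<in>{F}. poly_eval (c x) G = 0}"
      by (simp add: closure_of_minimal)
    with y show ?thesis by auto
  qed
  ultimately show "?R y" by auto
next
  assume R: "?R y"
  have "closedin (zariski A c) (zclosure A c S)" by simp
  then obtain \<F> where F: "zclosure A c S = {x\<in>A. \<forall>F\<in>\<F>. poly_eval (c x) F = 0}"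
    unfolding closedin_zariski by blast
  have "S \<subseteq> zclosure A c S" by (rule closure_of_subset) (simp add: assms)
  with F R show "y \<in> zclosure A c S" by blast
qed

lemma zclosure_mono: "S \<subseteq> T \<Longrightarrow> zclosure A c S \<subseteq> zclosure A c T"
  by (rule closure_of_mono)

lemma polyfun_vanish_zclosure:
  assumes "f ` X \<subseteq> A" "polyfun A (coord_funs c) D \<phi>" "\<And>x. x \<in> X \<Longrightarrow> \<phi> (f x) = 0"
    and "y \<in> zclosure A c (f ` X)"
  shows "\<phi> y = 0"
proof -
  obtain F where F: "\<And>p. p \<in> A \<Longrightarrow> \<phi> p = poly_eval (c p) F"
    using polyfun_imp_mpoly[OF assms(2)] by blast
  have "\<forall>x\<in>f ` X. poly_eval (c x) F = 0" using assms(1,3) F by fastforce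
  then show ?thesis using assms(4) in_zclosure_iff[OF assms(1)] F by metis
qed

lemma irreducibleinD:
  "irreduciblein T Y \<Longrightarrow> closedin T Z1 \<Longrightarrow> closedin T Z2 \<Longrightarrow> Y \<subseteq> Z1 \<union> Z2 \<Longrightarrow> Y \<subseteq> Z1 \<or> Y \<subseteq> Z2"
  by (simp add: irreduciblein_def)

text \<open>Polynomial functions on an irreducible set form a domain: the zero sets of the two
  factors cover \<open>Y\<close>, and that of \<open>f\<close> misses \<open>y0\<close>.\<close>

lemma irreducible_polyfun_mult:
  assumes irr: "irreduciblein (zariski A c) Y"
    and f: "polyfun A (coord_funs c) D f" and g: "polyfun A (coord_funs c) E g"
    and fg: "\<And>y. y \<in> Y \<Longrightarrow> f y * g y = 0" and y0: "y0 \<in> Y" "f y0 \<noteq> 0" and y: "y \<in> Y"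
  shows "g y = 0"
proof -
  obtain F where F: "\<And>p. p \<in> A \<Longrightarrow> f p = poly_eval (c p) F"
    using polyfun_imp_mpoly[OF f] by blast
  obtain G where G: "\<And>p. p \<in> A \<Longrightarrow> g p = poly_eval (c p) G"
    using polyfun_imp_mpoly[OF g] by blast
  have YA: "Y \<subseteq> A" using irr by (simp add: irreduciblein_def)
  let ?Z = "\<lambda>F. {x\<in>A. \<forall>H\<in>{F}. poly_eval (c x) H = 0}"
  have cl: "closedin (zariski A c) (?Z H)" for H
    unfolding closedin_zariski by blast
  have "Y \<subseteq> ?Z F \<union> ?Z G"
    using fg YA F G by fastforce
  then have "Y \<subseteq> ?Z F \<or> Y \<subseteq> ?Z G"
    by (rule irreducibleinD[OF irr cl cl])
  then show ?thesis using y0 y F G by auto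
qed

definition irr_chain :: "'p topology \<Rightarrow> nat \<Rightarrow> (nat \<Rightarrow> 'p set) \<Rightarrow> bool" where
  "irr_chain T n Y \<longleftrightarrow>
     (\<forall>i\<le>n. closedin T (Y i) \<and> irreduciblein T (Y i)) \<and> (\<forall>i<n. Y i \<subset> Y (Suc i))"

lemma krull_dim_irr_chain: "krull_dim T = Sup {enat n | n. \<exists>Y. irr_chain T n Y}"
  by (simp add: krull_dim_def irr_chain_def)

lemma irr_chain_append:
  assumes "irr_chain T n Y" "closedin T Z" "irreduciblein T Z" "Y n \<subset> Z"
  shows "irr_chain T (Suc n) (Y(Suc n := Z))"
  using assms unfolding irr_chain_def by (auto simp: le_Suc_eq less_Suc_eq)

text \<open>For slices of undiminished dimension: a chain found in the slice is already long enough,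
  and only its top has to be enlarged.\<close>

lemma irr_chain_replace_top:
  assumes Y: "irr_chain T n Y" and Z: "closedin T Z" "irreduciblein T Z" "Y n \<subseteq> Z"
  shows "irr_chain T n (Y(n := Z))"
  unfolding irr_chain_def
proof (intro conjI allI impI)
  fix i assume "i < n"
  then have "Y i \<subset> Y (Suc i)" using Y by (simp add: irr_chain_def)
  then show "(Y(n := Z)) i \<subset> (Y(n := Z)) (Suc i)"
    using \<open>i < n\<close> Z(3) by (cases "Suc i = n") auto
qed (use Y Z in \<open>auto simp: irr_chain_def\<close>)

lemma irr_chain_subset_top:
  assumes "irr_chain T n Y" "i \<le> n"
  shows "Y i \<subseteq> Y n"
  using assms(2)
proof (induction "n - i" arbitrary: i)
  case (Suc k)
  then have "Y i \<subset> Y (Suc i)" "Y (Suc i) \<subseteq> Y n"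
    using assms(1) by (auto simp: irr_chain_def)
  then show ?case by auto
qed simp

lemma irreduciblein_subtopology:
  assumes "closedin T V"
  shows "irreduciblein (subtopology T V) Y \<longleftrightarrow> irreduciblein T Y \<and> Y \<subseteq> V"
proof -
  have V: "V \<subseteq> topspace T" using assms by (rule closedin_subset)
  show ?thesis
  proof
    assume L: "irreduciblein (subtopology T V) Y"
    then have YV: "Y \<subseteq> V" "Y \<noteq> {}" using V by (auto simp: irreduciblein_def)
    have "Y \<subseteq> Z1 \<or> Y \<subseteq> Z2" if "closedin T Z1" "closedin T Z2" "Y \<subseteq> Z1 \<union> Z2" for Z1 Z2
    proof -
      have "closedin (subtopology T V) (Z1 \<inter> V)" "closedin (subtopology T V) (Z2 \<inter> V)"
        using that by (auto simp: closedin_subtopology)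
      moreover have "Y \<subseteq> Z1 \<inter> V \<union> Z2 \<inter> V" using that YV by auto
      ultimately have "Y \<subseteq> Z1 \<inter> V \<or> Y \<subseteq> Z2 \<inter> V" by (rule irreducibleinD[OF L])
      then show ?thesis by blast
    qed
    with YV V show "irreduciblein T Y \<and> Y \<subseteq> V" by (auto simp: irreduciblein_def)
  next
    assume R: "irreduciblein T Y \<and> Y \<subseteq> V"
    then show "irreduciblein (subtopology T V) Y"
      using V closedin_closed_subtopology[OF assms] by (auto simp: irreduciblein_def)
  qed
qed

text \<open>Chains in a neurovariety can thus be handled in the ambient topology, where a condition
  on the top member suffices.\<close>

lemma irr_chain_subtopology:
  assumes "closedin T V"
  shows "irr_chain (subtopology T V) n Y \<longleftrightarrow> irr_chain T n Y \<and> Y n \<subseteq> V"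
proof -
  have *: "irr_chain (subtopology T V) n Y \<longleftrightarrow> irr_chain T n Y \<and> (\<forall>i\<le>n. Y i \<subseteq> V)"
    by (auto simp: irr_chain_def irreduciblein_subtopology[OF assms]
        closedin_closed_subtopology[OF assms])
  show ?thesis unfolding * using irr_chain_subset_top by blast
qed

text \<open>Functions \<open>F i\<close> that vanish on \<open>Y (i - 1)\<close> but not on \<open>Y i\<close> are algebraically independent on
  \<open>Y n\<close>; the family \<open>\<phi>\<close> consists of the monomials in them with all exponents at most \<open>D\<close>.\<close>

lemma irr_chain_independent:
  assumes "irr_chain (zariski A c) n Y"
  shows "\<exists>e. \<forall>D. \<exists>(I :: nat list set) \<phi>. finite I \<and> card I = Suc D ^ n \<and>
    (\<forall>i\<in>I. polyfun A (coord_funs c) (D * e) (\<phi> i)) \<and>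
    (\<forall>a. (\<forall>y\<in>Y n. (\<Sum>i\<in>I. a i * \<phi> i y) = 0) \<longrightarrow> (\<forall>i\<in>I. a i = 0))"
  using assms
proof (induction n)
  case 0
  then have "Y 0 \<noteq> {}" by (auto simp: irr_chain_def irreduciblein_def)
  then show ?case
    by (intro exI[of _ 0] allI exI[of _ "{[]}"] exI[of _ "\<lambda>_ _. 1"]) (auto intro: polyfun_const)
next
  case (Suc n)
  from Suc.prems have "irr_chain (zariski A c) n Y" by (auto simp: irr_chain_def)
  from Suc.IH[OF this] obtain e where e: "\<And>D. \<exists>(I :: nat list set) \<phi>. finite I \<and>
    card I = Suc D ^ n \<and> (\<forall>i\<in>I. polyfun A (coord_funs c) (D * e) (\<phi> i)) \<and>
    (\<forall>a. (\<forall>y\<in>Y n. (\<Sum>i\<in>I. a i * \<phi> i y) = 0) \<longrightarrow> (\<forall>i\<in>I. a i = 0))" by blast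
  have cl: "closedin (zariski A c) (Y n)" and irr: "irreduciblein (zariski A c) (Y (Suc n))"
    and sub: "Y n \<subset> Y (Suc n)"
    using Suc.prems by (auto simp: irr_chain_def)
  have YA: "Y (Suc n) \<subseteq> A" using irr by (simp add: irreduciblein_def)
  obtain \<F> where FF: "Y n = {x\<in>A. \<forall>F\<in>\<F>. poly_eval (c x) F = 0}"
    using cl unfolding closedin_zariski by blast
  obtain y0 where y0: "y0 \<in> Y (Suc n)" "y0 \<notin> Y n" using sub by auto
  then obtain F where F: "F \<in> \<F>" "poly_eval (c y0) F \<noteq> 0" using FF YA by auto
  define f where "f = (\<lambda>x. poly_eval (c x) F)"
  obtain d where fd: "polyfun A (coord_funs c) d f"
    using polyfun_poly_eval unfolding f_def by blast
  have f0: "f y = 0" if "y \<in> Y n" for y using that FF F by (auto simp: f_def)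
  show ?case
  proof (rule exI, rule allI)
    fix D
    obtain I :: "nat list set" and \<phi> where I: "finite I" "card I = Suc D ^ n"
      and pf: "\<And>i. i \<in> I \<Longrightarrow> polyfun A (coord_funs c) (D * e) (\<phi> i)"
      and ind: "\<And>a. \<forall>y\<in>Y n. (\<Sum>i\<in>I. a i * \<phi> i y) = 0 \<Longrightarrow> \<forall>i\<in>I. a i = 0"
      using e[of D] by blast
    \<comment> \<open>Exponent vectors are lists; the new head is the exponent of \<open>f\<close>,
      which vanishes on \<open>Y n\<close> but not at \<open>y0\<close>.\<close>
    let ?I = "(\<lambda>(j, i). j # i) ` ({..D} \<times> I)"
    let ?\<phi> = "\<lambda>i y. f y ^ hd i * \<phi> (tl i) y"
    have inj: "inj_on (\<lambda>(j, i). j # i) ({..D} \<times> I)" by (auto simp: inj_on_def)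
    have fin: "finite ?I" "card ?I = Suc D ^ Suc n"
      using I by (simp_all add: card_image[OF inj] card_cartesian_product)
    have pf': "polyfun A (coord_funs c) (D * (d + e)) (?\<phi> i)" if "i \<in> ?I" for i
    proof -
      obtain j i' where i: "i = j # i'" "j \<le> D" "i' \<in> I" using \<open>i \<in> ?I\<close> by auto
      have "d * j + D * e \<le> D * (d + e)" using i(2) by (simp add: algebra_simps)
      then have "polyfun A (coord_funs c) (D * (d + e)) (\<lambda>y. f y ^ j * \<phi> i' y)"
        by (rule polyfun_mult_le[OF polyfun_power[OF fd] pf[OF i(3)]])
      then show ?thesis using i(1) by simp
    qed
    have ind': "\<forall>i\<in>?I. a i = 0" if a: "\<forall>y\<in>Y (Suc n). (\<Sum>i\<in>?I. a i * ?\<phi> i y) = 0" for a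
    proof -
      define g where "g j y = (\<Sum>i\<in>I. a (j # i) * \<phi> i y)" for j y
      have gpf: "polyfun A (coord_funs c) (D * e) (g j)" for j
        unfolding g_def by (intro polyfun_sum polyfun_scale pf)
      have sum: "(\<Sum>j\<le>D. f y ^ j * g j y) = 0" if "y \<in> Y (Suc n)" for y
      proof -
        have "(\<Sum>i\<in>?I. a i * ?\<phi> i y)
            = (\<Sum>(j, i)\<in>{..D} \<times> I. a (j # i) * (f y ^ j * \<phi> i y))"
          by (subst sum.reindex[OF inj]) (simp add: case_prod_unfold)
        also have "\<dots> = (\<Sum>j\<le>D. f y ^ j * g j y)"
          by (simp add: sum.cartesian_product[symmetric] g_def sum_distrib_left mult_ac)
        finally show ?thesis using a that by simp
      qed
      have "\<forall>i\<in>I. a (j # i) = 0" if "j \<le> D" for j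
        using that
      proof (induction j rule: less_induct)
        case (less j)
        have gz: "g j' y = 0" if "j' < j" for j' y
        proof -
          have "\<forall>i\<in>I. a (j' # i) = 0" using less.IH[OF that] that less.prems by simp
          then show ?thesis by (simp add: g_def)
        qed
        \<comment> \<open>Lower powers of \<open>f\<close> have been eliminated, so the relation
          reads \<open>f^j * h = 0\<close>. On the irreducible set \<open>Y (Suc n)\<close> the
          factor \<open>f^j\<close> is not identically zero, hence \<open>h\<close> is. On
          \<open>Y n\<close>, where \<open>f\<close> vanishes, only \<open>g j\<close> is left of
          \<open>h\<close>, and independence on \<open>Y n\<close> applies.\<close>
        define h where "h y = (\<Sum>k\<le>D - j. f y ^ k * g (j + k) y)" for y
        have hpf: "polyfun A (coord_funs c) (d * D + D * e) h"
          unfolding h_def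
        proof (intro polyfun_sum)
          fix k assume "k \<in> {..D - j}"
          then have "d * k + D * e \<le> d * D + D * e" by auto
          then show "polyfun A (coord_funs c) (d * D + D * e) (\<lambda>x. f x ^ k * g (j + k) x)"
            by (rule polyfun_mult_le[OF polyfun_power[OF fd] gpf])
        qed
        have fh: "f y ^ j * h y = 0" if "y \<in> Y (Suc n)" for y
        proof -
          have "(\<Sum>i\<le>D. f y ^ i * g i y) = (\<Sum>i\<in>{j..D}. f y ^ i * g i y)"
            by (rule sum.mono_neutral_right) (use gz in auto)
          also have "\<dots> = (\<Sum>k\<in>{..D - j}. f y ^ (j + k) * g (j + k) y)"
            by (rule sum.reindex_bij_witness[of _ "\<lambda>k. j + k" "\<lambda>i. i - j"])
              (use less.prems in auto)
          also have "\<dots> = f y ^ j * h y"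
            by (simp add: h_def sum_distrib_left power_add mult_ac)
          finally show ?thesis using sum[OF that] by simp
        qed
        have h0: "h y = 0" if "y \<in> Y (Suc n)" for y
          by (rule irreducible_polyfun_mult[OF irr polyfun_power[OF fd] hpf fh y0(1) _ that])
            (use F in \<open>simp_all add: f_def\<close>)
        have "g j y = 0" if "y \<in> Y n" for y
        proof -
          have "h y = (\<Sum>k\<in>{0}. f y ^ k * g (j + k) y)"
            unfolding h_def by (rule sum.mono_neutral_right) (use f0[OF that] in auto)
          with h0[of y] that sub show ?thesis by auto
        qed
        then show ?case using ind[of "\<lambda>i. a (j # i)"] unfolding g_def by blast
      qed
      then show ?thesis by auto
    qed
    show "\<exists>(I :: nat list set) \<phi>. finite I \<and> card I = Suc D ^ Suc n \<and>
      (\<forall>i\<in>I. polyfun A (coord_funs c) (D * (d + e)) (\<phi> i)) \<and>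
      (\<forall>a. (\<forall>y\<in>Y (Suc n). (\<Sum>i\<in>I. a i * \<phi> i y) = 0) \<longrightarrow> (\<forall>i\<in>I. a i = 0))"
    proof (rule exI[of _ ?I], rule exI[of _ ?\<phi>], intro conjI allI impI)
      show "finite ?I" "card ?I = Suc D ^ Suc n" by (fact fin)+
      show "\<forall>i\<in>?I. polyfun A (coord_funs c) (D * (d + e)) (?\<phi> i)" using pf' by blast
    qed (rule ind')
  qed
qed

text \<open>Gaussian elimination with more unknowns than equations, one equation \<open>z\<close> at
  a time.\<close>

lemma homogeneous_system_nontrivial:
  fixes \<phi> :: "'i \<Rightarrow> 'z \<Rightarrow> real"
  assumes "finite Z" "finite I" "card Z < card I"
  shows "\<exists>a. (\<exists>i\<in>I. a i \<noteq> 0) \<and> (\<forall>z\<in>Z. (\<Sum>i\<in>I. a i * \<phi> i z) = 0)"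
  using assms
proof (induction Z arbitrary: I \<phi>)
  case empty
  then have "I \<noteq> {}" by auto
  then show ?case by (intro exI[of _ "\<lambda>_. 1"]) auto
next
  case (insert z Z)
  show ?case
  proof (cases "\<forall>i\<in>I. \<phi> i z = 0")
    case True
    have "card Z < card I" using insert by auto
    from insert.IH[OF insert.prems(1) this, of \<phi>] True show ?thesis by auto
  next
    case False
    then obtain k where k: "k \<in> I" "\<phi> k z \<noteq> 0" by auto
    \<comment> \<open>The equation at \<open>z\<close> is solved for the unknown \<open>k\<close>,
      so every \<open>?\<psi> i\<close> vanishes at \<open>z\<close>; \<open>b\<close> below is the
      resulting value of that unknown.\<close>
    let ?\<psi> = "\<lambda>i x. \<phi> i x - \<phi> i z / \<phi> k z * \<phi> k x"
    have "card Z < card (I - {k})" using insert k by auto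
    from insert.IH[OF _ this, of ?\<psi>] insert.prems(1) obtain a where
      a: "\<exists>i\<in>I - {k}. a i \<noteq> 0" "\<forall>x\<in>Z. (\<Sum>i\<in>I - {k}. a i * ?\<psi> i x) = 0" by auto
    define b where "b = - (\<Sum>i\<in>I - {k}. a i * \<phi> i z) / \<phi> k z"
    have eq: "(\<Sum>i\<in>I. (a(k := b)) i * \<phi> i x) = (\<Sum>i\<in>I - {k}. a i * ?\<psi> i x)" for x
    proof -
      have "(\<Sum>i\<in>I. (a(k := b)) i * \<phi> i x) = b * \<phi> k x + (\<Sum>i\<in>I - {k}. a i * \<phi> i x)"
        using insert.prems(1) k(1) by (simp add: sum.remove)
      also have "b * \<phi> k x = - (\<Sum>i\<in>I - {k}. a i * (\<phi> i z / \<phi> k z * \<phi> k x))"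
        by (simp add: b_def sum_distrib_left sum_distrib_right sum_divide_distrib mult_ac)
      finally show ?thesis by (simp add: algebra_simps sum_subtractf)
    qed
    have "(\<Sum>i\<in>I - {k}. a i * ?\<psi> i z) = 0" using k(2) by simp
    with eq a show ?thesis by (intro exI[of _ "a(k := b)"]) auto
  qed
qed

text \<open>If \<open>n > s\<close>, then for large \<open>D\<close> there are more independent
  functions on \<open>Y n\<close> than determining points. Some nontrivial combination vanishes at
  these points, hence on the image and on its closure, which contains \<open>Y n\<close>.\<close>

lemma irr_chain_length_le_growth:
  assumes chain: "irr_chain (zariski A c) n Y" and sub: "Y n \<subseteq> zclosure A c (f ` X)"
    and fA: "f ` X \<subseteq> A" and gr: "growth X (coord_funs (\<lambda>x. c (f x))) s"
  shows "n \<le> s"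
proof (rule ccontr)
  assume "\<not> n \<le> s"
  obtain e where e: "\<And>D. \<exists>(I :: nat list set) \<phi>. finite I \<and>
    card I = Suc D ^ n \<and> (\<forall>i\<in>I. polyfun A (coord_funs c) (D * e) (\<phi> i)) \<and>
    (\<forall>a. (\<forall>y\<in>Y n. (\<Sum>i\<in>I. a i * \<phi> i y) = 0) \<longrightarrow> (\<forall>i\<in>I. a i = 0))"
    using irr_chain_independent[OF chain] by blast
  obtain C where C: "\<And>D. \<exists>Z. determining X (coord_funs (\<lambda>x. c (f x))) D Z \<and>
      card Z \<le> C * Suc D ^ s"
    using gr by (auto simp: growth_def)
  \<comment> \<open>Chosen so that the bound \<open>C * (Suc e * Suc D)^s\<close> on
    \<open>card Z\<close> equals \<open>D * Suc D^s\<close>, just below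
    \<open>Suc D^(s + 1)\<close>.\<close>
  define D where "D = C * Suc e ^ s"
  obtain I :: "nat list set" and \<phi> where I: "finite I" "card I = Suc D ^ n"
    and pf: "\<And>i. i \<in> I \<Longrightarrow> polyfun A (coord_funs c) (D * e) (\<phi> i)"
    and ind: "\<And>a. \<forall>y\<in>Y n. (\<Sum>i\<in>I. a i * \<phi> i y) = 0 \<Longrightarrow> \<forall>i\<in>I. a i = 0"
    using e[of D] by blast
  obtain Z where Z: "determining X (coord_funs (\<lambda>x. c (f x))) (D * e) Z"
    "card Z \<le> C * Suc (D * e) ^ s" using C by blast
  have "card Z \<le> C * (Suc e * Suc D) ^ s"
    using Z(2) by (rule order_trans) (intro mult_le_mono2 power_mono, auto)
  also have "\<dots> = D * Suc D ^ s" by (simp only: D_def power_mult_distrib mult.assoc)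
  also have "\<dots> < Suc D * Suc D ^ s" by simp
  also have "\<dots> \<le> Suc D ^ n"
    using \<open>\<not> n \<le> s\<close> power_increasing[of "Suc s" n "Suc D"] by simp
  finally have "card Z < card I" using I by simp
  moreover have "finite Z" using Z(1) by (simp add: determining_def)
  ultimately obtain a where a: "\<exists>i\<in>I. a i \<noteq> 0" "\<forall>z\<in>Z. (\<Sum>i\<in>I. a i * \<phi> i (f z)) = 0"
    using homogeneous_system_nontrivial[of Z I "\<lambda>i z. \<phi> i (f z)"] I(1) by blast
  let ?g = "\<lambda>y. \<Sum>i\<in>I. a i * \<phi> i y"
  have gpf: "polyfun A (coord_funs c) (D * e) ?g"
    by (intro polyfun_sum polyfun_scale pf)
  have "polyfun X (coord_funs (\<lambda>x. c (f x))) (D * e * 1) (\<lambda>x. ?g (f x))"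
    by (rule polyfun_comp[where \<phi> = f, OF gpf])
      (use fA in \<open>auto simp: coord_funs_def intro!: polyfun_gen\<close>)
  then have "?g (f x) = 0" if "x \<in> X" for x
    using Z(1) a(2) that by (auto simp: determining_def)
  then have "\<forall>y\<in>Y n. ?g y = 0"
    using polyfun_vanish_zclosure[OF fA gpf] sub by blast
  with ind a(1) show False by blast
qed

section \<open>Closures of polynomial images\<close>

text \<open>Two parameter points witnessing that neither closed set suffices are joined by a line
  inside the slab. Along it the two witnessing polynomials become nonzero univariate polynomials
  whose product vanishes.\<close>

lemma irreducible_zclosure_slab:
  fixes f :: "('j \<Rightarrow> real) \<Rightarrow> 'p"
  assumes fA: "f ` slab J \<gamma> \<subseteq> A"
    and pf: "\<And>i. polyfun UNIV vars e (\<lambda>x. c (f x) i)"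
  shows "irreduciblein (zariski A c) (zclosure A c (f ` slab J \<gamma>))"
  unfolding irreduciblein_def
proof (intro conjI allI impI)
  let ?Y = "zclosure A c (f ` slab J \<gamma>)"
  show "?Y \<subseteq> topspace (zariski A c)" by (rule closure_of_subset_topspace)
  have "f \<gamma> \<in> ?Y" using fA by (subst in_zclosure_iff) (auto simp: slab_def)
  then show "?Y \<noteq> {}" by auto
  fix Z1 Z2 assume cl: "closedin (zariski A c) Z1" "closedin (zariski A c) Z2" and Y: "?Y \<subseteq> Z1 \<union> Z2"
  have wit: "\<exists>F b. b \<in> slab J \<gamma> \<and> poly_eval (c (f b)) F \<noteq> 0 \<and> (\<forall>z\<in>Z. poly_eval (c z) F = 0)"
    if Z: "closedin (zariski A c) Z" and "\<not> ?Y \<subseteq> Z" for Z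
  proof -
    obtain \<F> where FF: "Z = {x\<in>A. \<forall>F\<in>\<F>. poly_eval (c x) F = 0}"
      using Z unfolding closedin_zariski by blast
    have "\<not> f ` slab J \<gamma> \<subseteq> Z"
      using Z that(2) closure_of_minimal by blast
    then obtain b where b: "b \<in> slab J \<gamma>" "f b \<notin> Z" by auto
    then obtain F where F: "F \<in> \<F>" "poly_eval (c (f b)) F \<noteq> 0" using FF fA by auto
    then have "\<forall>z\<in>Z. poly_eval (c z) F = 0" using FF by auto
    then show ?thesis using b F by blast
  qed
  show "?Y \<subseteq> Z1 \<or> ?Y \<subseteq> Z2"
  proof (rule ccontr)
    assume n: "\<not> (?Y \<subseteq> Z1 \<or> ?Y \<subseteq> Z2)"
    obtain F1 b1 where b1: "b1 \<in> slab J \<gamma>" "poly_eval (c (f b1)) F1 \<noteq> 0"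
      and F1: "\<forall>z\<in>Z1. poly_eval (c z) F1 = 0"
      using wit[OF cl(1)] n by blast
    obtain F2 b2 where b2: "b2 \<in> slab J \<gamma>" "poly_eval (c (f b2)) F2 \<noteq> 0"
      and F2: "\<forall>z\<in>Z2. poly_eval (c z) F2 = 0"
      using wit[OF cl(2)] n by blast
    let ?l = "\<lambda>t j. b1 j + t * (b2 j - b1 j)"
    have "\<exists>p. \<forall>t. poly_eval (c (f (?l t))) F = poly p t" for F
    proof -
      obtain D where "polyfun UNIV (coord_funs c) D (\<lambda>q. poly_eval (c q) F)"
        using polyfun_poly_eval by blast
      then have "polyfun UNIV vars (D * e) (\<lambda>x. poly_eval (c (f x)) F)"
        by (rule polyfun_comp) (auto simp: coord_funs_def pf[unfolded coord_funs_def])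
      from polyfun_line[OF this, of b1 "\<lambda>j. b2 j - b1 j"] show ?thesis by blast
    qed
    then obtain P where P: "\<And>F t. poly_eval (c (f (?l t))) F = poly (P F) t" by metis
    have l: "?l t \<in> slab J \<gamma>" for t using b1 b2 by (auto simp: slab_def)
    have "poly (P F1 * P F2) t = 0" for t
    proof -
      have "f (?l t) \<in> ?Y"
        using l[of t] closure_of_subset[of "f ` slab J \<gamma>" "zariski A c"] fA by auto
      then have "f (?l t) \<in> Z1 \<union> Z2" using Y by blast
      then show ?thesis using F1 F2 P[symmetric] by auto
    qed
    then have "P F1 * P F2 = 0" using poly_all_0_iff_0 by blast
    moreover have "P F1 \<noteq> 0" using P[of 0 F1] b1 by auto
    moreover have "P F2 \<noteq> 0" using P[of 1 F2] b2 by auto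
    ultimately show False by simp
  qed
qed

text \<open>A determining set for \<open>S\<close> also determines \<open>X\<close>, because
  polynomials vanishing on an image vanish on its closure. In the slicing argument this forces a
  slice of too small growth to have a strictly smaller closure.\<close>

lemma growth_zclosure_cong:
  assumes "S \<subseteq> X" "f ` X \<subseteq> A" "zclosure A c (f ` S) = zclosure A c (f ` X)"
    and "growth S (coord_funs (\<lambda>x. c (f x))) s"
  shows "growth X (coord_funs (\<lambda>x. c (f x))) s"
proof -
  have "determining X (coord_funs (\<lambda>x. c (f x))) D Z"
    if Z: "determining S (coord_funs (\<lambda>x. c (f x))) D Z" for D Z
    unfolding determining_def
  proof (intro conjI allI impI)
    show "Z \<subseteq> X" "finite Z" using Z assms(1) by (auto simp: determining_def)
    fix g assume g: "polyfun X (coord_funs (\<lambda>x. c (f x))) D g" "\<forall>z\<in>Z. g z = 0"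
    obtain F where F: "\<And>x. x \<in> X \<Longrightarrow> g x = poly_eval (c (f x)) F"
      using polyfun_imp_mpoly[OF g(1)] by blast
    have "polyfun S (coord_funs (\<lambda>x. c (f x))) (D * 1) (\<lambda>x. g x)"
      by (rule polyfun_comp[where \<phi> = "\<lambda>x. x", OF g(1)])
        (use assms(1) in \<open>auto intro: polyfun_gen\<close>)
    then have gS: "\<forall>x\<in>S. g x = 0" using Z g(2) by (auto simp: determining_def)
    show "\<forall>x\<in>X. g x = 0"
    proof
      fix x assume x: "x \<in> X"
      then have "f x \<in> zclosure A c (f ` S)"
        using assms(2,3) closure_of_subset[of "f ` X" "zariski A c"] by auto
      moreover have "\<forall>y\<in>f ` S. poly_eval (c y) F = 0" using gS F assms(1) by fastforce
      moreover have "f ` S \<subseteq> A" using assms(1,2) by auto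
      ultimately have "poly_eval (c (f x)) F = 0"
        using in_zclosure_iff[of "f ` S" A "f x" c] by blast
      then show "g x = 0" using F[OF x] by simp
    qed
  qed
  with assms(4) show ?thesis unfolding growth_def by meson
qed

text \<open>A function of degree \<open>D\<close> in the coordinates has degree \<open>D * e\<close>
  in the parameters, so determining sets of \<open>D * e + 1\<close> slices together determine the
  slab. The additional factor, linear in \<open>D\<close>, is the one unit of growth.\<close>

lemma growth_slab_slices:
  fixes f :: "('j \<Rightarrow> real) \<Rightarrow> 'p"
  assumes pf: "\<And>i. polyfun UNIV vars e (\<lambda>x. c (f x) i)" and j: "j \<notin> J"
    and gr: "\<And>t. growth (slab J (\<gamma>(j := t))) (coord_funs (\<lambda>x. c (f x))) s"
  shows "growth (slab (insert j J) \<gamma>) (coord_funs (\<lambda>x. c (f x))) (Suc s)"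
proof -
  let ?G = "coord_funs (\<lambda>x. c (f x))"
  let ?S = "\<lambda>t. slab J (\<gamma>(j := t))"
  \<comment> \<open>The slices whose growth bound holds with constant \<open>C\<close>. Countably
    many such sets cover the uncountable reals, so one of them is infinite and supplies enough
    slices for every \<open>D\<close>.\<close>
  define E where "E C = {t. \<forall>D. \<exists>Z. determining (?S t) ?G D Z \<and> card Z \<le> C * Suc D ^ s}" for C
  have "(\<Union>C. E C) = UNIV" using gr by (auto simp: E_def growth_def)
  then have "\<not> (\<forall>C. countable (E C))"
    using uncountable_UNIV_real countable_UN[of UNIV E] by auto
  then obtain C where "uncountable (E C)" by blast
  then have inf: "infinite (E C)" using countable_finite by blast
  show ?thesis unfolding growth_def
  proof (rule exI, rule allI)
    fix D
    obtain T where T: "finite T" "card T = Suc (D * e)" "T \<subseteq> E C"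
      using infinite_arbitrarily_large[OF inf] by blast
    have "\<forall>t\<in>T. \<exists>Z. determining (?S t) ?G D Z \<and> card Z \<le> C * Suc D ^ s"
      using T(3) by (auto simp: E_def)
    then obtain Z where Z: "\<And>t. t \<in> T \<Longrightarrow> determining (?S t) ?G D (Z t)"
      "\<And>t. t \<in> T \<Longrightarrow> card (Z t) \<le> C * Suc D ^ s" by metis
    have "determining (slab (insert j J) \<gamma>) ?G D (\<Union>t\<in>T. Z t)"
      unfolding determining_def
    proof (intro conjI allI impI ballI)
      show "(\<Union>t\<in>T. Z t) \<subseteq> slab (insert j J) \<gamma>"
        using Z(1) slab_subset unfolding determining_def by fastforce
      show "finite (\<Union>t\<in>T. Z t)" using T(1) Z(1) by (auto simp: determining_def)
      fix g x assume g: "polyfun (slab (insert j J) \<gamma>) ?G D g" "\<forall>z\<in>\<Union>t\<in>T. Z t. g z = 0"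
        and x: "x \<in> slab (insert j J) \<gamma>"
      obtain F where F: "\<And>y. y \<in> slab (insert j J) \<gamma> \<Longrightarrow> g y = poly_eval (c (f y)) F"
        using polyfun_imp_mpoly[OF g(1)] by blast
      text \<open>\<open>polyfun_slices\<close> needs a function that is polynomial everywhere, but \<open>g\<close> is one only on
        the slab; project onto the slab first.\<close>
      define \<pi> where "\<pi> y = (\<lambda>i. if i \<in> insert j J then y i else \<gamma> i)" for y
      have pi: "\<pi> y \<in> slab (insert j J) \<gamma>" for y by (auto simp: \<pi>_def slab_def)
      have pi_id: "\<pi> y = y" if "y \<in> slab (insert j J) \<gamma>" for y
        using that by (auto simp: \<pi>_def slab_def)
      have c\<pi>: "polyfun UNIV vars (e * 1) (\<lambda>y. c (f (\<pi> y)) i)" for i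
      proof (rule polyfun_comp[where \<phi> = \<pi>, OF pf])
        fix h :: "('j \<Rightarrow> real) \<Rightarrow> real" assume "h \<in> vars"
        then obtain k where "h = (\<lambda>x. x k)" by (auto simp: coord_funs_def)
        then show "polyfun UNIV vars 1 (\<lambda>y. h (\<pi> y))"
          by (cases "k \<in> insert j J") (simp_all add: \<pi>_def polyfun_vars[simplified] polyfun_const)
      qed simp
      have "polyfun UNIV vars (D * e) (\<lambda>y. g (\<pi> y))"
        by (rule polyfun_comp[OF g(1) pi]) (use c\<pi> in \<open>auto simp: coord_funs_def\<close>)
      then have "g (\<pi> x) = 0"
      proof (rule polyfun_slices[OF _ T(1)])
        show "D * e < card T" using T(2) by simp
        fix t assume t: "t \<in> T"
        have xt: "x(j := t) \<in> ?S t" using slab_upd[OF x j] .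
        have "polyfun (?S t) ?G (D * 1) (\<lambda>x. g x)"
          by (rule polyfun_comp[where \<phi> = "\<lambda>x. x", OF g(1)])
            (use slab_subset[of J \<gamma> j t] in \<open>auto intro: polyfun_gen\<close>)
        then have "g (x(j := t)) = 0"
          using Z(1)[OF t] g(2) t xt by (auto simp: determining_def)
        moreover have "\<pi> (x(j := t)) = x(j := t)"
          using pi_id subsetD[OF slab_subset xt] by blast
        ultimately show "g (\<pi> (x(j := t))) = 0" by simp
      qed
      then show "g x = 0" using pi_id[OF x] by simp
    qed
    moreover have "card (\<Union>t\<in>T. Z t) \<le> (Suc e * C) * Suc D ^ Suc s"
    proof -
      have "card (\<Union>t\<in>T. Z t) \<le> (\<Sum>t\<in>T. card (Z t))" by (rule card_UN_le[OF T(1)])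
      also have "\<dots> \<le> (\<Sum>t\<in>T. C * Suc D ^ s)" by (rule sum_mono) (rule Z(2))
      also have "\<dots> = Suc (D * e) * (C * Suc D ^ s)" using T(2) by simp
      also have "\<dots> \<le> (Suc e * Suc D) * (C * Suc D ^ s)"
        by (rule mult_le_mono1) simp
      finally show ?thesis by (simp only: power_Suc mult_ac)
    qed
    ultimately show "\<exists>Z. determining (slab (insert j J) \<gamma>) ?G D Z \<and>
        card Z \<le> (Suc e * C) * Suc D ^ Suc s" by blast
  qed
qed

text \<open>Induction on the free parameters. By \<open>growth_slab_slices\<close> some slice has no
  order below \<open>t - 1\<close>: its chain is one short at worst, and then the closure of the
  whole image is a strictly larger top.\<close>

lemma irr_chain_of_not_growth:
  fixes f :: "('j \<Rightarrow> real) \<Rightarrow> 'p"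
  assumes "finite J" and fA: "range f \<subseteq> A"
    and pf: "\<And>i. polyfun UNIV vars e (\<lambda>x. c (f x) i)"
    and "\<And>s. s < t \<Longrightarrow> \<not> growth (slab J \<gamma>) (coord_funs (\<lambda>x. c (f x))) s"
  shows "\<exists>Y. irr_chain (zariski A c) t Y \<and> Y t = zclosure A c (f ` slab J \<gamma>)"
  using assms(1,4)
proof (induction J arbitrary: \<gamma> t)
  case empty
  have "slab {} \<gamma> = {\<gamma>}" by (auto simp: slab_def)
  then have "growth (slab {} \<gamma>) (coord_funs (\<lambda>x. c (f x))) 0"
    by (simp add: growth_singleton)
  with empty have "t = 0" by auto
  then show ?case
    using irreducible_zclosure_slab[of f "{}" \<gamma> A e c] fA pf
    by (intro exI[of _ "\<lambda>_. zclosure A c (f ` slab {} \<gamma>)"]) (auto simp: irr_chain_def)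
next
  case (insert j J)
  let ?G = "coord_funs (\<lambda>x. c (f x))"
  let ?B = "slab (insert j J) \<gamma>" and ?S = "\<lambda>u. slab J (\<gamma>(j := u))"
  have fA': "f ` S \<subseteq> A" for S using fA by auto
  have irr: "irreduciblein (zariski A c) (zclosure A c (f ` ?B))"
    by (rule irreducible_zclosure_slab[OF fA' pf])
  have le: "zclosure A c (f ` ?S u) \<subseteq> zclosure A c (f ` ?B)" for u
    by (intro zclosure_mono image_mono slab_subset)
  show ?case
  proof (cases t)
    case 0
    then show ?thesis using irr
      by (intro exI[of _ "\<lambda>_. zclosure A c (f ` ?B)"]) (auto simp: irr_chain_def)
  next
    case (Suc t')
    show ?thesis
    proof (cases "\<exists>u. \<forall>s<t. \<not> growth (?S u) ?G s")
      case True
      then obtain u where "\<forall>s<t. \<not> growth (?S u) ?G s" by blast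
      with insert.IH[of t "\<gamma>(j := u)"] obtain Y where
        Y: "irr_chain (zariski A c) t Y" "Y t = zclosure A c (f ` ?S u)" by blast
      have "irr_chain (zariski A c) t (Y(t := zclosure A c (f ` ?B)))"
        by (rule irr_chain_replace_top[OF Y(1) _ irr]) (use Y(2) le[of u] in auto)
      moreover have "(Y(t := zclosure A c (f ` ?B))) t = zclosure A c (f ` ?B)" by simp
      ultimately show ?thesis by blast
    next
      case False
      then have gr: "growth (?S u) ?G t'" for u
        using Suc growth_mono by (metis less_Suc_eq_le)
      \<comment> \<open>Otherwise every slice would have order \<open>t' - 1\<close>, so the whole
        slab would have order \<open>t'\<close>, which is less than \<open>t\<close>.\<close>
      obtain u where u: "\<forall>s<t'. \<not> growth (?S u) ?G s"
      proof (rule ccontr)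
        assume n: "\<not> thesis"
        then have ex: "\<exists>s<t'. growth (?S u) ?G s" for u using that by blast
        then obtain t'' where t'': "t' = Suc t''" by (cases t') auto
        have "growth (?S u) ?G t''" for u
          using ex[of u] growth_mono t'' by (metis less_Suc_eq_le)
        from growth_slab_slices[where f = f, OF pf insert(2) this]
        have "growth ?B ?G t'" using t'' by simp
        then show False using insert.prems[of t'] Suc by auto
      qed
      with insert.IH[of t' "\<gamma>(j := u)"] obtain Y where
        Y: "irr_chain (zariski A c) t' Y" "Y t' = zclosure A c (f ` ?S u)" by blast
      \<comment> \<open>Equal closures would transfer the order \<open>t'\<close> from the slice to
        the whole slab.\<close>
      have "zclosure A c (f ` ?S u) \<noteq> zclosure A c (f ` ?B)"
        using growth_zclosure_cong[OF slab_subset fA' _ gr] insert.prems[of t'] Suc by blast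
      with le[of u] have "Y t' \<subset> zclosure A c (f ` ?B)" unfolding Y(2) by blast
      then have "irr_chain (zariski A c) t (Y(t := zclosure A c (f ` ?B)))"
        unfolding Suc using irr_chain_append[OF Y(1) _ irr] by simp
      moreover have "(Y(t := zclosure A c (f ` ?B))) t = zclosure A c (f ` ?B)" by simp
      ultimately show ?thesis by blast
    qed
  qed
qed

section \<open>Coefficients and values of homogeneous polynomials\<close>

definition monomials :: "nat \<Rightarrow> nat \<Rightarrow> (nat \<Rightarrow>\<^sub>0 nat) set" where
  "monomials e n = {m. Poly_Mapping.keys m \<subseteq> {..<n} \<and> monom_degree m = e}"

text \<open>Turns the count of monomials into the stars-and-bars count for lists of given length and
  sum.\<close>

lemma bij_betw_monomials:
  "bij_betw (\<lambda>m. map (Poly_Mapping.lookup m) [0..<n]) (monomials e n)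
    {l. length l = n \<and> sum_list l = e}"
proof (rule bij_betw_byWitness[where f' = Poly_Mapping.nth])
  have keys: "Poly_Mapping.keys (Poly_Mapping.nth l) \<subseteq> {..<length l}" for l :: "nat list"
  proof
    fix v assume "v \<in> Poly_Mapping.keys (Poly_Mapping.nth l)"
    then have "nth_default 0 l v \<noteq> 0" unfolding in_keys_iff nth.rep_eq .
    then show "v \<in> {..<length l}" by (auto simp: nth_default_def split: if_splits)
  qed
  show "\<forall>m\<in>monomials e n. Poly_Mapping.nth (map (Poly_Mapping.lookup m) [0..<n]) = m"
  proof
    fix m assume "m \<in> monomials e n"
    then have "Poly_Mapping.lookup m v = 0" if "\<not> v < n" for v
      using that by (auto simp: monomials_def in_keys_iff)
    then show "Poly_Mapping.nth (map (Poly_Mapping.lookup m) [0..<n]) = m"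
      by (intro poly_mapping_eqI) (auto simp: nth.rep_eq nth_default_def)
  qed
  show "\<forall>l\<in>{l. length l = n \<and> sum_list l = e}.
      map (Poly_Mapping.lookup (Poly_Mapping.nth l)) [0..<n] = l"
    by (auto simp: nth.rep_eq nth_default_def intro!: nth_equalityI)
  have "sum_list (map (Poly_Mapping.lookup m) [0..<n]) = monom_degree m"
    if "Poly_Mapping.keys m \<subseteq> {..<n}" for m
    using monom_degree_superset[OF _ that]
    by (simp add: interv_sum_list_conv_sum_set_nat atLeast0LessThan)
  then show "(\<lambda>m. map (Poly_Mapping.lookup m) [0..<n]) ` monomials e n
      \<subseteq> {l. length l = n \<and> sum_list l = e}"
    by (auto simp: monomials_def)
  have "monom_degree (Poly_Mapping.nth l) = sum_list l" for l :: "nat list"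
    using monom_degree_superset[OF _ keys, of l]
    by (simp add: nth.rep_eq nth_default_def sum_list_sum_nth atLeast0LessThan)
  then show "Poly_Mapping.nth ` {l. length l = n \<and> sum_list l = e} \<subseteq> monomials e n"
    using keys by (fastforce simp: monomials_def)
qed

lemma card_monomials: "card (monomials e n) = (e + n - 1) choose e"
  using bij_betw_same_card[OF bij_betw_monomials[of n e]] by (simp add: card_length_sum_list)

lemma finite_monomials: "finite (monomials e n)"
proof -
  have "finite {l. length l = n \<and> sum_list l = e}"
  proof (rule finite_subset)
    show "{l. length l = n \<and> sum_list l = e} \<subseteq> {l. set l \<subseteq> {..e} \<and> length l = n}"
      using member_le_sum_list by fastforce
    show "finite {l. set l \<subseteq> {..e} \<and> length l = n}"
      by (rule finite_lists_length_eq) simp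
  qed
  then show ?thesis using bij_betw_finite[OF bij_betw_monomials[of n e]] by blast
qed

lemma keys_Sym: "p \<in> Sym e n \<Longrightarrow> Poly_Mapping.keys p \<subseteq> monomials e n"
  by (auto simp: Sym_def monomials_def)

text \<open>Lagrange interpolation at the nodes \<open>0, ..., e\<close>: \<open>\<beta> l\<close>
  is the coefficient of degree \<open>j\<close> in the basis polynomial of node
  \<open>l\<close>.\<close>

lemma coeff_functional:
  "\<exists>\<beta>. \<forall>k\<le>e. (\<Sum>l\<le>e. \<beta> l * real l ^ k) = (if k = j then 1 else 0)"
proof -
  define q where "q l = (\<Prod>i\<in>{..e} - {l}. [:- real i, 1:])" for l
  define L where "L l = smult (1 / poly (q l) (real l)) (q l)" for l
  have q0: "poly (q l) (real l) \<noteq> 0" for l by (simp add: q_def poly_prod)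
  have L1: "poly (L l) (real l) = 1" for l using q0 by (simp add: L_def)
  have L0: "poly (L l) (real i) = 0" if "i \<le> e" "i \<noteq> l" for i l
    using that by (auto simp: L_def q_def poly_prod)
  have dq: "degree (L l) \<le> e" if "l \<le> e" for l
  proof -
    have "degree (q l) \<le> sum (degree \<circ> (\<lambda>i. [:- real i, 1:])) ({..e} - {l})"
      unfolding q_def by (rule degree_prod_sum_le) simp
    also have "\<dots> = e" using that by simp
    finally show ?thesis by (simp add: L_def degree_smult_le order_trans[OF degree_smult_le])
  qed
  have interp: "monom 1 k = (\<Sum>l\<le>e. smult (real l ^ k) (L l))" (is "?m = ?s") if "k \<le> e" for k
  proof (rule ccontr)
    assume ne: "?m \<noteq> ?s"
    have "poly (?m - ?s) (real i) = 0" if "i \<le> e" for i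
    proof -
      have "poly ?s (real i) = (\<Sum>l\<in>{i}. real l ^ k * poly (L l) (real i))"
        unfolding poly_sum poly_smult
        by (rule sum.mono_neutral_right) (use L0 that in auto)
      then show ?thesis by (simp add: L1 poly_monom)
    qed
    then have "real ` {..e} \<subseteq> {x. poly (?m - ?s) x = 0}" by auto
    then have "card (real ` {..e}) \<le> card {x. poly (?m - ?s) x = 0}"
      using ne by (intro card_mono poly_roots_finite) auto
    also have "\<dots> \<le> degree (?m - ?s)" using ne by (intro card_poly_roots_bound) auto
    also have "\<dots> \<le> e"
      by (intro degree_diff_le order_trans[OF degree_monom_le] that degree_sum_le
          order_trans[OF degree_smult_le] dq) auto
    finally show False by (simp add: card_image)
  qed
  have "(\<Sum>l\<le>e. coeff (L l) j * real l ^ k) = (if k = j then 1 else 0)" if "k \<le> e" for k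
  proof -
    have "coeff (monom 1 k) j = (\<Sum>l\<le>e. coeff (L l) j * real l ^ k)"
      unfolding interp[OF that] by (simp add: coeff_sum mult.commute)
    then show ?thesis by (simp add: coeff_monom)
  qed
  then show ?thesis by (intro exI[of _ "\<lambda>l. coeff (L l) j"] allI impI)
qed

text \<open>A product of univariate interpolation functionals, one per variable, evaluated on the
  integer grid. The points and weights are independent of \<open>p\<close>, so a coefficient of a
  network is a fixed linear combination of its values.\<close>

lemma lookup_as_values:
  assumes m: "m \<in> monomials e n"
  shows "\<exists>I \<beta>. finite I \<and> (\<forall>p\<in>Sym e n. Poly_Mapping.lookup p m =
    (\<Sum>i\<in>I. \<beta> i * poly_eval (\<lambda>v. real (i v)) p))"
proof -
  obtain b where b: "\<And>j k. k \<le> e \<Longrightarrow> (\<Sum>l\<le>e. b j l * real l ^ k) = (if k = j then 1 else 0)"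
    using coeff_functional[of e] by metis
  define I where "I = {..<n} \<rightarrow>\<^sub>E {..e}"
  define \<beta> where "\<beta> i = (\<Prod>v<n. b (Poly_Mapping.lookup m v) (i v))" for i
  have fin: "finite I" unfolding I_def by (intro finite_PiE) auto
  have mono: "(\<Sum>i\<in>I. \<beta> i * monom_eval (\<lambda>v. real (i v)) m') = (if m' = m then 1 else 0)"
    if m': "m' \<in> monomials e n" for m'
  proof -
    have le: "Poly_Mapping.lookup m' v \<le> e" if "v < n" for v
    proof -
      have "monom_degree m' = (\<Sum>v<n. Poly_Mapping.lookup m' v)"
        using m' by (intro monom_degree_superset) (auto simp: monomials_def)
      then show ?thesis
        using m' that member_le_sum[of v "{..<n}" "Poly_Mapping.lookup m'"]
        by (auto simp: monomials_def)
    qed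
    have "(\<Sum>i\<in>I. \<beta> i * monom_eval (\<lambda>v. real (i v)) m')
        = (\<Sum>i\<in>I. \<Prod>v<n. b (Poly_Mapping.lookup m v) (i v)
            * real (i v) ^ Poly_Mapping.lookup m' v)"
      using m' by (intro sum.cong refl)
        (auto simp: \<beta>_def monomials_def prod.distrib monom_eval_superset[of "{..<n}"])
    \<comment> \<open>On a monomial the sum over the grid factorises, and each factor tests one
      exponent.\<close>
    also have "\<dots> = (\<Prod>v<n. \<Sum>l\<le>e. b (Poly_Mapping.lookup m v) l
            * real l ^ Poly_Mapping.lookup m' v)"
      unfolding I_def by (subst prod_sum_PiE) auto
    also have "\<dots> = (\<Prod>v<n. if Poly_Mapping.lookup m' v = Poly_Mapping.lookup m v then 1 else 0)"
      by (intro prod.cong refl b le) auto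
    also have "\<dots> = (if m' = m then 1 else 0)"
    proof (cases "m' = m")
      case False
      then obtain v where v: "Poly_Mapping.lookup m' v \<noteq> Poly_Mapping.lookup m v"
        using poly_mapping_eqI[of m' m] by auto
      have "v < n"
      proof (rule ccontr)
        assume "\<not> v < n"
        then have "v \<notin> Poly_Mapping.keys m" "v \<notin> Poly_Mapping.keys m'"
          using m m' by (auto simp: monomials_def)
        with v show False by (simp add: in_keys_iff)
      qed
      then show ?thesis using False v by auto
    qed simp
    finally show ?thesis .
  qed
  have "Poly_Mapping.lookup p m = (\<Sum>i\<in>I. \<beta> i * poly_eval (\<lambda>v. real (i v)) p)"
    if p: "p \<in> Sym e n" for p
  proof -
    have "(\<Sum>i\<in>I. \<beta> i * poly_eval (\<lambda>v. real (i v)) p)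
      = (\<Sum>i\<in>I. \<Sum>m'\<in>monomials e n. Poly_Mapping.lookup p m'
          * (\<beta> i * monom_eval (\<lambda>v. real (i v)) m'))"
      by (simp add: poly_eval_superset[OF finite_monomials keys_Sym[OF p]] sum_distrib_left mult_ac)
    also have "\<dots> = (\<Sum>m'\<in>monomials e n. Poly_Mapping.lookup p m'
          * (\<Sum>i\<in>I. \<beta> i * monom_eval (\<lambda>v. real (i v)) m'))"
      by (subst sum.swap) (simp add: sum_distrib_left)
    also have "\<dots> = (\<Sum>m'\<in>monomials e n. if m' = m then Poly_Mapping.lookup p m' else 0)"
      by (intro sum.cong refl) (simp add: mono)
    also have "\<dots> = Poly_Mapping.lookup p m" using m finite_monomials by simp
    finally show ?thesis ..
  qed
  with fin show ?thesis by blast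
qed

section \<open>The ambient space\<close>

definition ambient_index :: "nat list \<Rightarrow> nat \<Rightarrow> (nat \<times> (nat \<Rightarrow>\<^sub>0 nat)) set" where
  "ambient_index ds r = {..<last ds} \<times> monomials (r ^ (layers ds - 1)) (hd ds)"

text \<open>A linear parametrisation inverse to \<open>coords\<close>; it presents the ambient space
  as an image of a slab, so that the irreducibility result for images applies to it.\<close>

definition ambient_point ::
  "nat list \<Rightarrow> nat \<Rightarrow> (nat \<times> (nat \<Rightarrow>\<^sub>0 nat) \<Rightarrow> real) \<Rightarrow> nat mpoly vec" where
  "ambient_point ds r x = vec (last ds) (\<lambda>k.
     \<Sum>m\<in>monomials (r ^ (layers ds - 1)) (hd ds). Poly_Mapping.single m (x (k, m)))"

lemma finite_ambient_index: "finite (ambient_index ds r)"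
  by (simp add: ambient_index_def finite_monomials)

lemma card_ambient_index:
  "card (ambient_index ds r) =
    last ds * ((hd ds + r ^ (layers ds - 1) - 1) choose (r ^ (layers ds - 1)))"
  by (simp add: ambient_index_def card_cartesian_product card_monomials add.commute)

lemma coords_ambient_point:
  "coords (ambient_point ds r x) i = (if i \<in> ambient_index ds r then x i else 0)"
  by (cases i) (simp add: coords_def ambient_point_def ambient_index_def lookup_sum lookup_single
      when_def finite_monomials)

lemma ambient_point_in: "ambient_point ds r x \<in> ambient ds r"
proof -
  have "Poly_Mapping.single m a \<in> Sym e n" if "m \<in> monomials e n" for m a e n
    using that by (auto simp: Sym_def monomials_def)
  then show ?thesis
    by (auto simp: ambient_def ambient_point_def intro: Sym_sum)
qed

lemma ambient_point_coords: "q \<in> ambient ds r \<Longrightarrow> ambient_point ds r (coords q) = q"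
proof -
  assume q: "q \<in> ambient ds r"
  have "(\<Sum>m\<in>monomials e n. Poly_Mapping.single m (Poly_Mapping.lookup p m)) = p"
    if "p \<in> Sym e n" for p e n
    by (subst (2) mpoly_sum_monomials, rule sum.mono_neutral_right)
      (use keys_Sym[OF that] finite_monomials in \<open>auto simp: in_keys_iff\<close>)
  then show ?thesis
    using q by (intro eq_vecI) (auto simp: ambient_def ambient_point_def coords_def)
qed

lemma coords_ambient_in_slab:
  assumes "q \<in> ambient ds r"
  shows "coords q \<in> slab (ambient_index ds r) (\<lambda>_. 0)"
  unfolding slab_def
proof (intro CollectI allI impI)
  fix i assume "i \<notin> ambient_index ds r"
  then have "coords (ambient_point ds r (coords q)) i = 0" by (simp add: coords_ambient_point)
  then show "coords q i = 0" by (simp only: ambient_point_coords[OF assms])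
qed

lemma ambient_eq_image: "ambient ds r = ambient_point ds r ` slab (ambient_index ds r) (\<lambda>_. 0)"
proof (intro equalityI subsetI)
  fix q assume q: "q \<in> ambient ds r"
  show "q \<in> ambient_point ds r ` slab (ambient_index ds r) (\<lambda>_. 0)"
    by (rule image_eqI[where x = "coords q"])
      (simp_all only: ambient_point_coords[OF q] coords_ambient_in_slab[OF q])
qed (auto intro: ambient_point_in)

lemma polyfun_coords_ambient_point:
  "polyfun UNIV vars 1 (\<lambda>x. coords (ambient_point ds r x) i)"
  by (cases "i \<in> ambient_index ds r") (simp_all add: coords_ambient_point polyfun_vars[simplified] polyfun_const)

text \<open>Over a one-point space \<open>growth_join\<close> reduces to the grid bound; normalising
  merely clears the coordinates outside \<open>ambient_index\<close>.\<close>

lemma growth_ambient: "growth (ambient ds r) (coord_funs coords) (card (ambient_index ds r))"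
proof -
  have "growth (ambient ds r) (coord_funs coords) (0 + card (ambient_index ds r))"
  proof (rule growth_join[where join = "\<lambda>x _. ambient_point ds r x" and N = "{}"
        and \<gamma> = "\<lambda>_. 0" and X = "{()}" and G = "{}" and e = 0 and e' = 1])
    show "growth {()} {} 0" by (rule growth_singleton)
    show "finite (ambient_index ds r)" by (rule finite_ambient_index)
    have "q = ambient_point ds r (coords q)" if "q \<in> ambient ds r" for q
      using ambient_point_coords[OF that] by simp
    then show "ambient ds r = {ambient_point ds r x |x u. u \<in> {()}}"
      using ambient_point_in[of ds r] by blast
    fix x :: "nat \<times> (nat \<Rightarrow>\<^sub>0 nat) \<Rightarrow> real"
    let ?x = "\<lambda>i. if i \<in> ambient_index ds r then x i else 0"
    have "?x \<in> slab (ambient_index ds r) (\<lambda>_. 0)" by (simp add: slab_def)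
    moreover have "h (ambient_point ds r x) = h (ambient_point ds r ?x)"
      if "h \<in> coord_funs coords" for h
      using that by (auto simp: coord_funs_def coords_ambient_point)
    ultimately show "\<exists>x'\<in>slab (ambient_index ds r) (\<lambda>_. 0). \<exists>u'\<in>{()}.
        \<forall>h\<in>coord_funs coords. h (ambient_point ds r x) = h (ambient_point ds r x')"
      by (intro bexI[of _ ?x] bexI[of _ "()"] ballI) auto
  qed (use polyfun_coords_ambient_point in
      \<open>auto simp: coord_funs_def[of coords] polyfun_const simp del: One_nat_def\<close>)
  then show ?thesis by simp
qed

lemma irreducible_ambient: "irreduciblein (zariski (ambient ds r) coords) (ambient ds r)"
proof -
  have "zclosure (ambient ds r) coords (ambient ds r) = ambient ds r"
    using closure_of_topspace[of "zariski (ambient ds r) coords"] by simp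
  then show ?thesis
    using irreducible_zclosure_slab[of "ambient_point ds r" "ambient_index ds r" "\<lambda>_. 0"
        "ambient ds r" 1 coords] polyfun_coords_ambient_point
    by (simp flip: ambient_eq_image)
qed

lemma irr_chain_le_ambient:
  assumes "irr_chain (zariski (ambient ds r) coords) n Y"
  shows "n \<le> card (ambient_index ds r)"
proof (rule irr_chain_length_le_growth[where f = "\<lambda>q. q" and X = "ambient ds r", OF assms])
  have "Y n \<subseteq> ambient ds r"
    using assms by (auto simp: irr_chain_def irreduciblein_def)
  then show "Y n \<subseteq> zclosure (ambient ds r) coords ((\<lambda>q. q) ` ambient ds r)"
    using closure_of_topspace[of "zariski (ambient ds r) coords"] by simp
qed (use growth_ambient in simp_all)

section \<open>Growth for networks\<close>

text \<open>Instead of the coefficients, we use as generators the values of the network map at all points;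
  both generate the same algebra, in the same degrees.\<close>

definition net_values :: "nat list \<Rightarrow> nat \<Rightarrow> (real mat list \<Rightarrow> real) set" where
  "net_values ds r = {\<lambda>Ws. pnn r Ws y $ k | y k. y \<in> carrier_vec (hd ds) \<and> k < last ds}"

lemma net_valuesI:
  "y \<in> carrier_vec (hd ds) \<Longrightarrow> k < last ds \<Longrightarrow> (\<lambda>Ws. pnn r Ws y $ k) \<in> net_values ds r"
  unfolding net_values_def by blast

lemma pnn_conv_param_map:
  assumes "architecture ds" "Ws \<in> weights ds" "y \<in> carrier_vec (hd ds)" "k < last ds"
  shows "pnn r Ws y $ k = poly_eval (\<lambda>i. y $ i) (param_map ds r Ws $ k)"
proof -
  have "dim_vec (param_map ds r Ws) = last ds"
    using param_map_in_ambient[OF assms(1,2)] by (auto simp: ambient_def)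
  then show ?thesis using assms(4) poly_eval_param_map[OF assms(2,3), symmetric] by simp
qed

lemma pnn_carrier:
  assumes "architecture ds" "Ws \<in> weights ds" "y \<in> carrier_vec (hd ds)"
  shows "pnn r Ws y \<in> carrier_vec (last ds)"
  using param_map_in_ambient[OF assms(1,2), of r] poly_eval_param_map[OF assms(2,3), of r, symmetric]
  by (auto simp: ambient_def)

lemma net_values_polyfun_coeffs:
  assumes ds: "architecture ds" and h: "h \<in> net_values ds r"
  shows "polyfun (weights ds) (coord_funs (\<lambda>Ws. coords (param_map ds r Ws))) 1 h"
proof -
  obtain y k where h: "h = (\<lambda>Ws. pnn r Ws y $ k)" and y: "y \<in> carrier_vec (hd ds)" and k: "k < last ds"
    using h by (auto simp: net_values_def)
  let ?M = "monomials (r ^ (layers ds - 1)) (hd ds)"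
  have "polyfun (weights ds) (coord_funs (\<lambda>Ws. coords (param_map ds r Ws))) 1
    (\<lambda>Ws. \<Sum>m\<in>?M. monom_eval (\<lambda>i. y $ i) m * coords (param_map ds r Ws) (k, m))"
    by (intro polyfun_sum polyfun_scale polyfun_coord)
  then show ?thesis
  proof (rule polyfun_cong)
    fix Ws assume Ws: "Ws \<in> weights ds"
    have A: "param_map ds r Ws \<in> ambient ds r" by (rule param_map_in_ambient[OF ds Ws])
    then have S: "param_map ds r Ws $ k \<in> Sym (r ^ (layers ds - 1)) (hd ds)"
      and d: "dim_vec (param_map ds r Ws) = last ds"
      using k by (auto simp: ambient_def)
    show "(\<Sum>m\<in>?M. monom_eval (\<lambda>i. y $ i) m * coords (param_map ds r Ws) (k, m)) = h Ws"
      unfolding h pnn_conv_param_map[OF ds Ws y k] poly_eval_superset[OF finite_monomials keys_Sym[OF S]]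
      using k d by (simp add: coords_def mult.commute)
  qed
qed

lemma coeffs_polyfun_net_values:
  assumes ds: "architecture ds"
  shows "polyfun (weights ds) (net_values ds r) 1 (\<lambda>Ws. coords (param_map ds r Ws) (k, m))"
proof (cases "k < last ds \<and> m \<in> monomials (r ^ (layers ds - 1)) (hd ds)")
  case True
  let ?e = "r ^ (layers ds - 1)"
  obtain I \<beta> where I: "\<And>p. p \<in> Sym ?e (hd ds) \<Longrightarrow> Poly_Mapping.lookup p m =
    (\<Sum>i\<in>I. \<beta> i * poly_eval (\<lambda>v. real (i v)) p)"
    using lookup_as_values[of m ?e "hd ds"] True by blast
  let ?y = "\<lambda>i. vec (hd ds) (\<lambda>v. real (i v))"
  have "polyfun (weights ds) (net_values ds r) 1 (\<lambda>Ws. \<Sum>i\<in>I. \<beta> i * pnn r Ws (?y i) $ k)"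
    by (intro polyfun_sum polyfun_scale polyfun_gen) (use True in \<open>auto intro: net_valuesI\<close>)
  then show ?thesis
  proof (rule polyfun_cong)
    fix Ws assume Ws: "Ws \<in> weights ds"
    have A: "param_map ds r Ws \<in> ambient ds r" by (rule param_map_in_ambient[OF ds Ws])
    then have S: "param_map ds r Ws $ k \<in> Sym ?e (hd ds)"
      and d: "dim_vec (param_map ds r Ws) = last ds"
      using True by (auto simp: ambient_def)
    have "pnn r Ws (?y i) $ k = poly_eval (\<lambda>v. real (i v)) (param_map ds r Ws $ k)" for i
    proof -
      \<comment> \<open>The entries of \<open>?y i\<close> beyond its dimension are not controlled,
        but the homogeneous polynomial involves only variables below \<open>hd ds\<close>.\<close>
      have "monom_eval (\<lambda>v. ?y i $ v) m' = monom_eval (\<lambda>v. real (i v)) m'"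
        if "m' \<in> Poly_Mapping.keys (param_map ds r Ws $ k)" for m'
        unfolding monom_eval_def using S that by (intro prod.cong) (fastforce simp: Sym_def)+
      then show ?thesis
        using True pnn_conv_param_map[OF ds Ws, of "?y i" k r]
        by (simp add: poly_eval_def cong: sum.cong)
    qed
    then show "(\<Sum>i\<in>I. \<beta> i * pnn r Ws (?y i) $ k) = coords (param_map ds r Ws) (k, m)"
      using True d I[OF S] by (simp add: coords_def)
  qed
next
  case False
  show ?thesis
  proof (rule polyfun_cong[OF polyfun_const[of _ _ _ 0]])
    fix Ws assume Ws: "Ws \<in> weights ds"
    have A: "param_map ds r Ws \<in> ambient ds r" by (rule param_map_in_ambient[OF ds Ws])
    have "(k, m) \<notin> ambient_index ds r" using False by (simp add: ambient_index_def)
    then show "0 = coords (param_map ds r Ws) (k, m)"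
      using coords_ambient_in_slab[OF A] by (simp add: slab_def)
  qed
qed

lemma growth_values_iff_coeffs:
  assumes "architecture ds"
  shows "growth (weights ds) (net_values ds r) s \<longleftrightarrow>
    growth (weights ds) (coord_funs (\<lambda>Ws. coords (param_map ds r Ws))) s"
proof
  assume "growth (weights ds) (net_values ds r) s"
  then show "growth (weights ds) (coord_funs (\<lambda>Ws. coords (param_map ds r Ws))) s"
    by (rule growth_comp[where \<phi> = "\<lambda>Ws. Ws" and e = 1])
      (use coeffs_polyfun_net_values[OF assms] in \<open>auto simp: coord_funs_def\<close>)
next
  assume "growth (weights ds) (coord_funs (\<lambda>Ws. coords (param_map ds r Ws))) s"
  then show "growth (weights ds) (net_values ds r) s"
    by (rule growth_comp[where \<phi> = "\<lambda>Ws. Ws" and e = 1])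
      (use net_values_polyfun_coeffs[OF assms] in auto)
qed

section \<open>Splitting off the first or the last layer of a network\<close>

lemma weights_Cons_iff:
  "ds \<noteq> [] \<Longrightarrow> W # Ws \<in> weights (d # ds) \<longleftrightarrow> W \<in> carrier_mat (hd ds) d \<and> Ws \<in> weights ds"
  by (cases ds) (auto simp: weights_def layers_def less_Suc_eq_0_disj)

lemma weights_ConsD:
  assumes "Ws \<in> weights (d # ds)" "ds \<noteq> []"
  obtains V Vs where "Ws = V # Vs" "V \<in> carrier_mat (hd ds) d" "Vs \<in> weights ds"
proof (cases Ws)
  case Nil
  then show ?thesis using assms by (simp add: weights_def layers_def)
next
  case (Cons V Vs)
  then show ?thesis using assms that weights_Cons_iff by blast
qed

lemma weights_snoc_iff:
  assumes "ds \<noteq> []"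
  shows "Ws @ [W] \<in> weights (ds @ [d]) \<longleftrightarrow> Ws \<in> weights ds \<and> W \<in> carrier_mat d (last ds)"
proof -
  obtain n where n: "length ds = Suc n" using assms by (cases ds) auto
  have "last ds = ds ! n" using assms n by (simp add: last_conv_nth)
  then show ?thesis
    using n by (auto simp: weights_def layers_def All_less_Suc nth_append cong: conj_cong)
qed

lemma weights_snocD:
  assumes "Ws \<in> weights (ds @ [d])" "ds \<noteq> []"
  obtains Vs V where "Ws = Vs @ [V]" "V \<in> carrier_mat d (last ds)" "Vs \<in> weights ds"
proof (cases Ws rule: rev_cases)
  case Nil
  then show ?thesis using assms by (simp add: weights_def layers_def)
next
  case (snoc Vs V)
  then show ?thesis using assms that weights_snoc_iff by blast
qed

lemma pnn_Cons: "Vs \<noteq> [] \<Longrightarrow> pnn r (W # Vs) y = pnn r Vs (map_vec (\<lambda>a. a ^ r) (W *\<^sub>v y))"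
  by (cases Vs) auto

lemma pnn_snoc: "Vs \<noteq> [] \<Longrightarrow> pnn r (Vs @ [W]) y = W *\<^sub>v map_vec (\<lambda>a. a ^ r) (pnn r Vs y)"
  by (induction r Vs y rule: pnn.induct) auto

lemma pnn_Cons_cong: "V *\<^sub>v u = V' *\<^sub>v u' \<Longrightarrow> pnn r (V # Vs) u = pnn r (V' # Vs) u'"
  by (cases Vs) auto

lemma mult_mat_vec_nth:
  "W \<in> carrier_mat m n \<Longrightarrow> v \<in> carrier_vec n \<Longrightarrow> i < m \<Longrightarrow>
    (W *\<^sub>v v) $ i = (\<Sum>j<n. W $$ (i, j) * v $ j)"
  by (auto simp: scalar_prod_def atLeast0LessThan intro!: sum.cong)

lemma architecture_Cons: "architecture ds \<Longrightarrow> 0 < d \<Longrightarrow> architecture (d # ds)"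
  by (auto simp: architecture_def)

lemma architecture_snoc: "architecture ds \<Longrightarrow> 0 < d \<Longrightarrow> architecture (ds @ [d])"
  by (auto simp: architecture_def)

lemma architecture_pos: "architecture ds \<Longrightarrow> ds \<noteq> [] \<and> 0 < hd ds \<and> 0 < last ds"
  by (cases "ds = []") (simp_all add: architecture_def)

lemma weights_ne: "architecture ds \<Longrightarrow> Ws \<in> weights ds \<Longrightarrow> Ws \<noteq> []"
  by (auto simp: architecture_def weights_def layers_def)

text \<open>The input must be allowed to depend on the parameters: in the induction, the input of
  the remaining layers is the output of the first, whose degree is \<open>(1 + a) * r\<close> after
  activation.\<close>

lemma pnn_polyfun:
  fixes X :: "'w set" and H :: "('w \<Rightarrow> real) set"
  assumes "architecture ds"
  shows "\<exists>E. \<forall>Ms v k. (\<forall>\<theta>\<in>X. Ms \<theta> \<in> weights ds \<and> v \<theta> \<in> carrier_vec (hd ds)) \<longrightarrow>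
    (\<forall>l i j. l < layers ds \<longrightarrow> i < ds ! Suc l \<longrightarrow> j < ds ! l \<longrightarrow> polyfun X H 1 (\<lambda>\<theta>. (Ms \<theta> ! l) $$ (i, j))) \<longrightarrow>
    (\<forall>i<hd ds. polyfun X H a (\<lambda>\<theta>. v \<theta> $ i)) \<longrightarrow> k < last ds \<longrightarrow>
    polyfun X H E (\<lambda>\<theta>. pnn r (Ms \<theta>) (v \<theta>) $ k)"
  using assms
proof (induction ds arbitrary: a)
  case Nil
  then show ?case by (simp add: architecture_def)
next
  case (Cons d ds)
  then have ne: "ds \<noteq> []" by (auto simp: architecture_def)
  have first: "polyfun X H (1 + a) (\<lambda>\<theta>. (hd (Ms \<theta>) *\<^sub>v v \<theta>) $ i)"
    if w: "\<forall>\<theta>\<in>X. Ms \<theta> \<in> weights (d # ds) \<and> v \<theta> \<in> carrier_vec (hd (d # ds))"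
      and e: "\<forall>l i j. l < layers (d # ds) \<longrightarrow> i < (d # ds) ! Suc l \<longrightarrow> j < (d # ds) ! l \<longrightarrow>
        polyfun X H 1 (\<lambda>\<theta>. (Ms \<theta> ! l) $$ (i, j))"
      and v: "\<forall>i<hd (d # ds). polyfun X H a (\<lambda>\<theta>. v \<theta> $ i)" and i: "i < hd ds" for Ms v i
  proof -
    have "polyfun X H (1 + a) (\<lambda>\<theta>. \<Sum>j<d. (Ms \<theta> ! 0) $$ (i, j) * v \<theta> $ j)"
      by (intro polyfun_sum polyfun_mult) (use e[rule_format, of 0] v i ne in \<open>auto simp: layers_def hd_conv_nth\<close>)
    then show ?thesis
    proof (rule polyfun_cong)
      fix \<theta> assume "\<theta> \<in> X"
      then have M: "Ms \<theta> \<in> weights (d # ds)" and vc: "v \<theta> \<in> carrier_vec d" using w by auto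
      from M ne obtain V Vs where "Ms \<theta> = V # Vs" "V \<in> carrier_mat (hd ds) d"
        by (rule weights_ConsD)
      then show "(\<Sum>j<d. (Ms \<theta> ! 0) $$ (i, j) * v \<theta> $ j) = (hd (Ms \<theta>) *\<^sub>v v \<theta>) $ i"
        using mult_mat_vec_nth[OF _ vc i] by simp
    qed
  qed
  show ?case
  proof (cases "length ds = 1")
    case True
    then obtain d' where d': "ds = [d']" by (auto simp: length_Suc_conv)
    have eq: "pnn r Ws y = hd Ws *\<^sub>v y" if Ws: "Ws \<in> weights (d # ds)" for Ws y
    proof -
      obtain V Vs where "Ws = V # Vs" "Vs \<in> weights ds"
        using Ws ne by (rule weights_ConsD)
      then show ?thesis using d' by (simp add: weights_def layers_def)
    qed
    show ?thesis
    proof (intro exI[of _ "1 + a"] allI impI)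
      fix Ms v k
      assume *: "\<forall>\<theta>\<in>X. Ms \<theta> \<in> weights (d # ds) \<and> v \<theta> \<in> carrier_vec (hd (d # ds))"
        "\<forall>l i j. l < layers (d # ds) \<longrightarrow> i < (d # ds) ! Suc l \<longrightarrow> j < (d # ds) ! l \<longrightarrow>
          polyfun X H 1 (\<lambda>\<theta>. (Ms \<theta> ! l) $$ (i, j))"
        "\<forall>i<hd (d # ds). polyfun X H a (\<lambda>\<theta>. v \<theta> $ i)" "k < last (d # ds)"
      have "polyfun X H (1 + a) (\<lambda>\<theta>. (hd (Ms \<theta>) *\<^sub>v v \<theta>) $ k)"
        by (rule first[OF *(1-3)]) (use *(4) d' in simp)
      then show "polyfun X H (1 + a) (\<lambda>\<theta>. pnn r (Ms \<theta>) (v \<theta>) $ k)"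
        by (rule polyfun_cong) (use *(1) in \<open>simp add: eq\<close>)
    qed
  next
    case False
    then have ads: "architecture ds" using Cons.prems ne by (cases ds) (auto simp: architecture_def Suc_le_eq)
    obtain E where E: "\<And>Ms v k. \<forall>\<theta>\<in>X. Ms \<theta> \<in> weights ds \<and> v \<theta> \<in> carrier_vec (hd ds) \<Longrightarrow>
      \<forall>l i j. l < layers ds \<longrightarrow> i < ds ! Suc l \<longrightarrow> j < ds ! l \<longrightarrow> polyfun X H 1 (\<lambda>\<theta>. (Ms \<theta> ! l) $$ (i, j)) \<Longrightarrow>
      \<forall>i<hd ds. polyfun X H ((1 + a) * r) (\<lambda>\<theta>. v \<theta> $ i) \<Longrightarrow> k < last ds \<Longrightarrow>
      polyfun X H E (\<lambda>\<theta>. pnn r (Ms \<theta>) (v \<theta>) $ k)"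
      using Cons.IH[OF ads, of "(1 + a) * r"] by blast
    show ?thesis
    proof (intro exI[of _ E] allI impI)
      fix Ms v k
      assume *: "\<forall>\<theta>\<in>X. Ms \<theta> \<in> weights (d # ds) \<and> v \<theta> \<in> carrier_vec (hd (d # ds))"
        "\<forall>l i j. l < layers (d # ds) \<longrightarrow> i < (d # ds) ! Suc l \<longrightarrow> j < (d # ds) ! l \<longrightarrow>
          polyfun X H 1 (\<lambda>\<theta>. (Ms \<theta> ! l) $$ (i, j))"
        "\<forall>i<hd (d # ds). polyfun X H a (\<lambda>\<theta>. v \<theta> $ i)" "k < last (d # ds)"
      let ?v = "\<lambda>\<theta>. map_vec (\<lambda>a. a ^ r) (hd (Ms \<theta>) *\<^sub>v v \<theta>)"
      have dec: "hd (Ms \<theta>) \<in> carrier_mat (hd ds) d \<and> tl (Ms \<theta>) \<in> weights ds \<and>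
          Ms \<theta> = hd (Ms \<theta>) # tl (Ms \<theta>)" if "\<theta> \<in> X" for \<theta>
      proof -
        have "Ms \<theta> \<in> weights (d # ds)" using *(1) that by auto
        from this ne show ?thesis by (rule weights_ConsD) simp
      qed
      have "polyfun X H E (\<lambda>\<theta>. pnn r (tl (Ms \<theta>)) (?v \<theta>) $ k)"
      proof (rule E)
        show "\<forall>\<theta>\<in>X. tl (Ms \<theta>) \<in> weights ds \<and> ?v \<theta> \<in> carrier_vec (hd ds)"
        proof
          fix \<theta> assume "\<theta> \<in> X"
          with dec have "hd (Ms \<theta>) \<in> carrier_mat (hd ds) d" "tl (Ms \<theta>) \<in> weights ds" by auto
          then show "tl (Ms \<theta>) \<in> weights ds \<and> ?v \<theta> \<in> carrier_vec (hd ds)"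
            by (auto intro!: carrier_vecI)
        qed
        show "\<forall>l i j. l < layers ds \<longrightarrow> i < ds ! Suc l \<longrightarrow> j < ds ! l \<longrightarrow>
            polyfun X H 1 (\<lambda>\<theta>. (tl (Ms \<theta>) ! l) $$ (i, j))"
        proof (intro allI impI)
          fix l i j assume l: "l < layers ds" "i < ds ! Suc l" "j < ds ! l"
          have "polyfun X H 1 (\<lambda>\<theta>. (Ms \<theta> ! Suc l) $$ (i, j))"
            using *(2)[rule_format, of "Suc l" i j] l by (simp add: layers_def)
          then show "polyfun X H 1 (\<lambda>\<theta>. (tl (Ms \<theta>) ! l) $$ (i, j))"
            by (rule polyfun_cong) (metis dec nth_Cons_Suc)
        qed
        show "\<forall>i<hd ds. polyfun X H ((1 + a) * r) (\<lambda>\<theta>. ?v \<theta> $ i)"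
        proof (intro allI impI)
          fix i assume i: "i < hd ds"
          show "polyfun X H ((1 + a) * r) (\<lambda>\<theta>. ?v \<theta> $ i)"
          proof (rule polyfun_cong[OF polyfun_power[OF first[OF *(1-3) i]]])
            fix \<theta> assume "\<theta> \<in> X"
            from dec[OF this, THEN conjunct1] show "(hd (Ms \<theta>) *\<^sub>v v \<theta>) $ i ^ r = ?v \<theta> $ i"
              using i by simp
          qed
        qed
        show "k < last ds" using *(4) ne by simp
      qed
      then show "polyfun X H E (\<lambda>\<theta>. pnn r (Ms \<theta>) (v \<theta>) $ k)"
      proof (rule polyfun_cong)
        fix \<theta> assume "\<theta> \<in> X"
        then have "tl (Ms \<theta>) \<noteq> []" "Ms \<theta> = hd (Ms \<theta>) # tl (Ms \<theta>)"
          using dec weights_ne[OF ads] by auto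
        then show "pnn r (tl (Ms \<theta>)) (?v \<theta>) $ k = pnn r (Ms \<theta>) (v \<theta>) $ k"
          using pnn_Cons[of "tl (Ms \<theta>)" r "hd (Ms \<theta>)"] by simp
      qed
    qed
  qed
qed

text \<open>The first column of the new matrix is normalised to 1 by rescaling the neurons of the new
  hidden layer.\<close>

lemma growth_weights_Cons:
  assumes ds: "architecture ds" and d: "0 < d"
    and gr: "growth (weights ds) (net_values ds r) s"
  shows "growth (weights (d # ds)) (net_values (d # ds) r) (s + (d * hd ds - hd ds))"
proof -
  define n where "n = hd ds"
  define J where "J = {..<n} \<times> {1..<d}"
  have ne: "ds \<noteq> []" using architecture_pos[OF ds] by simp
  have cards: "card J = d * hd ds - hd ds"
    by (simp add: J_def n_def card_cartesian_product algebra_simps)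
  let ?join = "\<lambda>x Ws. mat n d x # Ws"
  obtain E where E: "\<And>Ms v k.
    \<forall>\<theta>\<in>UNIV. Ms \<theta> \<in> weights (d # ds) \<and> v \<theta> \<in> carrier_vec (hd (d # ds)) \<Longrightarrow>
    \<forall>l i j. l < layers (d # ds) \<longrightarrow> i < (d # ds) ! Suc l \<longrightarrow> j < (d # ds) ! l \<longrightarrow>
      polyfun UNIV (vars :: ((nat \<times> nat \<Rightarrow> real) \<Rightarrow> real) set) 1 (\<lambda>\<theta>. (Ms \<theta> ! l) $$ (i, j)) \<Longrightarrow>
    \<forall>i<hd (d # ds). polyfun UNIV vars 0 (\<lambda>\<theta>. v \<theta> $ i) \<Longrightarrow> k < last (d # ds) \<Longrightarrow>
    polyfun UNIV vars E (\<lambda>\<theta>. pnn r (Ms \<theta>) (v \<theta>) $ k)"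
    using pnn_polyfun[OF architecture_Cons[OF ds d], of UNIV vars 0 r] by blast
  have "growth (weights (d # ds)) (net_values (d # ds) r) (s + card J)"
  proof (rule growth_join[where join = ?join and N = "{..<n} \<times> {0}" and \<gamma> = "\<lambda>_. 1"
        and e = 1 and e' = E, OF gr])
    show "finite J" "finite ({..<n} \<times> {0::nat})" by (simp_all add: J_def)
    show "weights (d # ds) = {?join x u |x u. u \<in> weights ds}" (is "_ = ?R")
    proof (intro equalityI subsetI)
      fix Ws assume "Ws \<in> weights (d # ds)"
      from this ne obtain V Vs where V: "Ws = V # Vs" "V \<in> carrier_mat (hd ds) d" "Vs \<in> weights ds"
        by (rule weights_ConsD)
      have "V = mat n d (\<lambda>ij. V $$ ij)" using V(2) by (auto simp: n_def)
      with V show "Ws \<in> ?R" by blast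
    next
      fix Ws assume "Ws \<in> ?R"
      then show "Ws \<in> weights (d # ds)" using ne by (auto simp: weights_Cons_iff n_def)
    qed
    fix h x assume "h \<in> net_values (d # ds) r"
    then obtain y k where h: "h = (\<lambda>Ws. pnn r Ws y $ k)" and y: "y \<in> carrier_vec d"
      and k: "k < last ds"
      using ne by (auto simp: net_values_def)
    \<comment> \<open>The extended network at \<open>y\<close> is the old network at
      \<open>?y\<close>, so its value is again a generator; hence \<open>e = 1\<close>.\<close>
    let ?y = "map_vec (\<lambda>a. a ^ r) (mat n d x *\<^sub>v y)"
    show "polyfun (weights ds) (net_values ds r) 1 (\<lambda>u. h (?join x u))"
    proof (rule polyfun_cong)
      show "polyfun (weights ds) (net_values ds r) 1 (\<lambda>u. pnn r u ?y $ k)"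
        by (rule polyfun_gen[OF net_valuesI]) (auto simp: k n_def intro!: carrier_vecI)
      fix u assume "u \<in> weights ds"
      then show "pnn r u ?y $ k = h (?join x u)"
        using weights_ne[OF ds] by (simp add: h pnn_Cons)
    qed
  next
    fix u h assume u: "u \<in> weights ds" and "h \<in> net_values (d # ds) r"
    then obtain y k where h: "h = (\<lambda>Ws. pnn r Ws y $ k)" and y: "y \<in> carrier_vec d"
      and k: "k < last (d # ds)"
      by (auto simp: net_values_def)
    show "polyfun UNIV vars E (\<lambda>x. h (?join x u))"
      unfolding h
    proof (rule E)
      show "\<forall>x\<in>UNIV. ?join x u \<in> weights (d # ds) \<and> y \<in> carrier_vec (hd (d # ds))"
        using y u ne by (simp add: weights_Cons_iff n_def)
      show "\<forall>l i j. l < layers (d # ds) \<longrightarrow> i < (d # ds) ! Suc l \<longrightarrow> j < (d # ds) ! l \<longrightarrow>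
          polyfun UNIV vars 1 (\<lambda>x. (?join x u ! l) $$ (i, j))"
      proof (intro allI impI)
        fix l i j assume l: "l < layers (d # ds)" "i < (d # ds) ! Suc l" "j < (d # ds) ! l"
        show "polyfun UNIV vars 1 (\<lambda>x. (?join x u ! l) $$ (i, j))"
        proof (cases l)
          case 0
          with l ne have "i < n" "j < d" by (simp_all add: n_def hd_conv_nth)
          with 0 show ?thesis by (simp add: polyfun_vars[simplified])
        qed (simp add: polyfun_const)
      qed
    qed (use k in \<open>simp_all add: polyfun_const\<close>)
  next
    fix x :: "nat \<times> nat \<Rightarrow> real" and u
    assume u: "u \<in> weights ds" and pos: "\<And>j. j \<in> {..<n} \<times> {0} \<Longrightarrow> 0 < x j"
    obtain d1 ds' where ds': "ds = n # d1 # ds'"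
      using ds by (auto simp: architecture_def n_def Suc_le_length_iff numeral_2_eq_2)
    obtain V Vs where V: "u = V # Vs" "V \<in> carrier_mat d1 n" "Vs \<in> weights (d1 # ds')"
      using weights_ConsD[OF u[unfolded ds'] list.distinct(2)] unfolding list.sel by metis
    \<comment> \<open>Each row is divided by its first entry. As the activation turns a factor
      \<open>c\<close> into \<open>c^r\<close>, the next matrix absorbs the \<open>r\<close>-th
      power in the corresponding column. The default 1 agrees with the values that the slab
      prescribes outside \<open>J\<close>.\<close>
    define x' where "x' = (\<lambda>(i, j). if i < n \<and> j < d then x (i, j) / x (i, 0) else 1)"
    define V' where "V' = mat d1 n (\<lambda>(i, k). V $$ (i, k) * x (k, 0) ^ r)"
    have "x' \<in> slab J (\<lambda>_. 1)"
    proof -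
      have "x (i, 0) \<noteq> 0" if "i < n" for i using pos[of "(i, 0)"] that by simp
      then show ?thesis by (auto simp: slab_def x'_def J_def Suc_le_eq)
    qed
    moreover have V'u: "V' # Vs \<in> weights ds"
      unfolding ds' using V(3) by (subst weights_Cons_iff) (simp_all add: V'_def)
    moreover have "h (?join x u) = h (?join x' (V' # Vs))" if hin: "h \<in> net_values (d # ds) r" for h
    proof -
      obtain y k where h: "h = (\<lambda>Ws. pnn r Ws y $ k)" and y: "y \<in> carrier_vec d"
        using hin by (auto simp: net_values_def)
      let ?y = "\<lambda>x. map_vec (\<lambda>a. a ^ r) (mat n d x *\<^sub>v y)"
      have yk: "?y x $ k = x (k, 0) ^ r * ?y x' $ k" if k: "k < n" for k
      proof -
        have nz: "x (k, 0) \<noteq> 0" using pos[of "(k, 0)"] k by simp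
        have "(mat n d x *\<^sub>v y) $ k = (\<Sum>j<d. x (k, j) * y $ j)"
          by (subst mult_mat_vec_nth[OF _ y k]) (use k in auto)
        also have "\<dots> = x (k, 0) * (\<Sum>j<d. x' (k, j) * y $ j)"
          using nz k by (simp add: sum_distrib_left x'_def)
        also have "(\<Sum>j<d. x' (k, j) * y $ j) = (mat n d x' *\<^sub>v y) $ k"
          by (subst mult_mat_vec_nth[OF _ y k]) (use k in auto)
        finally show ?thesis using k by (simp add: power_mult_distrib)
      qed
      have yc: "?y z \<in> carrier_vec n" for z by (auto intro!: carrier_vecI)
      have "V *\<^sub>v ?y x = V' *\<^sub>v ?y x'"
      proof (rule eq_vecI)
        fix i assume "i < dim_vec (V' *\<^sub>v ?y x')"
        then have i: "i < d1" by (simp add: V'_def)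
        have V'c: "V' \<in> carrier_mat d1 n" by (simp add: V'_def)
        show "(V *\<^sub>v ?y x) $ i = (V' *\<^sub>v ?y x') $ i"
          unfolding mult_mat_vec_nth[OF V(2) yc i] mult_mat_vec_nth[OF V'c yc i]
          by (intro sum.cong refl) (use i yk in \<open>simp add: V'_def\<close>)
      qed (use V(2) in \<open>simp add: V'_def\<close>)
      then show ?thesis
        unfolding h V(1) by (simp add: pnn_Cons pnn_Cons_cong[of V _ V'])
    qed
    ultimately show "\<exists>x'\<in>slab J (\<lambda>_. 1). \<exists>u'\<in>weights ds.
        \<forall>h\<in>net_values (d # ds) r. h (?join x u) = h (?join x' u')"
      by (intro bexI[of _ x'] bexI[of _ "V' # Vs"] ballI)
  qed
  then show ?thesis unfolding cards .
qed

text \<open>Here the first row of the new matrix is normalised to 1. This takes \<open>r\<close>-th roots of the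
  scaling factors, which exist on the positive orthant.\<close>

lemma growth_weights_snoc:
  assumes r: "0 < r" and ds: "architecture ds" and d: "0 < d"
    and gr: "growth (weights ds) (net_values ds r) s"
  shows "growth (weights (ds @ [d])) (net_values (ds @ [d]) r) (s + (last ds * d - last ds))"
proof -
  define n where "n = last ds"
  define J where "J = {1..<d} \<times> {..<n}"
  have ne: "ds \<noteq> []" using architecture_pos[OF ds] by simp
  have cards: "card J = last ds * d - last ds"
    by (simp add: J_def n_def card_cartesian_product algebra_simps)
  let ?join = "\<lambda>x Ws. Ws @ [mat d n x]"
  have val: "pnn r (?join x u) y $ k = (\<Sum>i<n. x (k, i) * (pnn r u y $ i) ^ r)"
    if u: "u \<in> weights ds" and y: "y \<in> carrier_vec (hd ds)" and k: "k < d" for x u y k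
  proof -
    have c: "pnn r u y \<in> carrier_vec n" unfolding n_def by (rule pnn_carrier[OF ds u y])
    then have c': "map_vec (\<lambda>a. a ^ r) (pnn r u y) \<in> carrier_vec n" by simp
    show ?thesis
      unfolding pnn_snoc[OF weights_ne[OF ds u]]
      by (subst mult_mat_vec_nth[OF _ c' k]) (use c k in \<open>auto intro!: sum.cong\<close>)
  qed
  have vals: "\<exists>y k. y \<in> carrier_vec (hd ds) \<and> k < d \<and> h = (\<lambda>Ws. pnn r Ws y $ k)"
    if "h \<in> net_values (ds @ [d]) r" for h
    using that ne by (auto simp: net_values_def)
  have "growth (weights (ds @ [d])) (net_values (ds @ [d]) r) (s + card J)"
  proof (rule growth_join[where join = ?join and N = "{0} \<times> {..<n}" and \<gamma> = "\<lambda>_. 1"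
        and e = r and e' = 1, OF gr])
    show "finite J" "finite ({0::nat} \<times> {..<n})" by (simp_all add: J_def)
    show "weights (ds @ [d]) = {?join x u |x u. u \<in> weights ds}" (is "_ = ?R")
    proof (intro equalityI subsetI)
      fix Ws assume "Ws \<in> weights (ds @ [d])"
      from this ne obtain Vs V where V: "Ws = Vs @ [V]" "V \<in> carrier_mat d (last ds)" "Vs \<in> weights ds"
        by (rule weights_snocD)
      have "V = mat d n (\<lambda>ij. V $$ ij)" using V(2) by (auto simp: n_def)
      with V show "Ws \<in> ?R" by blast
    next
      fix Ws assume "Ws \<in> ?R"
      then show "Ws \<in> weights (ds @ [d])" using ne by (auto simp: weights_snoc_iff n_def)
    qed
    fix h x assume "h \<in> net_values (ds @ [d]) r"
    from vals[OF this] obtain y k where y: "y \<in> carrier_vec (hd ds)" and k: "k < d"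
      and h: "h = (\<lambda>Ws. pnn r Ws y $ k)" by blast
    \<comment> \<open>The old outputs now pass through an activation, which is why
      \<open>e = r\<close>.\<close>
    have "polyfun (weights ds) (net_values ds r) (1 * r)
        (\<lambda>u. \<Sum>i<n. x (k, i) * (pnn r u y $ i) ^ r)"
      by (intro polyfun_sum polyfun_scale polyfun_power polyfun_gen net_valuesI y) (auto simp: n_def)
    then show "polyfun (weights ds) (net_values ds r) r (\<lambda>u. h (?join x u))"
      unfolding mult_1 by (rule polyfun_cong) (simp add: h val y k)
  next
    fix u h assume u: "u \<in> weights ds" and "h \<in> net_values (ds @ [d]) r"
    with vals obtain y k where y: "y \<in> carrier_vec (hd ds)" and k: "k < d"
      and h: "h = (\<lambda>Ws. pnn r Ws y $ k)" by blast
    have "polyfun UNIV vars 1 (\<lambda>x. \<Sum>i<n. (pnn r u y $ i) ^ r * x (k, i))"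
      by (intro polyfun_sum polyfun_scale polyfun_vars)
    then show "polyfun UNIV vars 1 (\<lambda>x. h (?join x u))"
      by (rule polyfun_cong) (simp add: h val u y k mult.commute)
  next
    fix x :: "nat \<times> nat \<Rightarrow> real" and u
    assume u: "u \<in> weights ds" and pos: "\<And>j. j \<in> {0} \<times> {..<n} \<Longrightarrow> 0 < x j"
    define ds' where "ds' = butlast ds"
    have ds': "ds = ds' @ [n]" using ne by (simp add: ds'_def n_def)
    have ds'_ne: "ds' \<noteq> []" using ds ds' by (auto simp: architecture_def)
    obtain Vs V where V: "u = Vs @ [V]" "V \<in> carrier_mat n (last ds')" "Vs \<in> weights ds'"
      using weights_snocD[OF u[unfolded ds'] ds'_ne] by metis
    define m where "m = last ds'"
    \<comment> \<open>Each column is divided by its entry in row 0; in compensation, the old last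
      matrix has its row \<open>i\<close> multiplied by the \<open>r\<close>-th root of that
      entry.\<close>
    define x' where "x' = (\<lambda>(i, j). if i < d \<and> j < n then x (i, j) / x (0, j) else 1)"
    define V' where "V' = mat n m (\<lambda>(i, j). root r (x (0, i)) * V $$ (i, j))"
    have nz: "0 < x (0, j)" if "j < n" for j using pos[of "(0, j)"] that by simp
    have x's: "x' \<in> slab J (\<lambda>_. 1)"
      using nz by (fastforce simp: slab_def x'_def J_def Suc_le_eq)
    have V'u: "Vs @ [V'] \<in> weights ds"
      unfolding ds' using V(3) ds'_ne by (subst weights_snoc_iff) (simp_all add: V'_def m_def)
    have last: "pnn r (Vs @ [V']) y $ i = root r (x (0, i)) * pnn r u y $ i"
      if y: "y \<in> carrier_vec (hd ds)" and i: "i < n" for y i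
    proof -
      \<comment> \<open>The vector fed to the old last matrix: the raw input if the old network has
        a single layer, otherwise activated outputs.\<close>
      define w where "w = (if Vs = [] then y else map_vec (\<lambda>a. a ^ r) (pnn r Vs y))"
      have eq: "pnn r (Vs @ [U]) y = U *\<^sub>v w" for U by (simp add: w_def pnn_snoc)
      have w: "w \<in> carrier_vec m"
      proof (cases "length ds' = 1")
        case True
        then have "Vs = []" using V(3) by (simp add: weights_def layers_def)
        moreover have "hd ds = m" using True ds' by (auto simp: m_def length_Suc_conv)
        ultimately show ?thesis using y by (simp add: w_def)
      next
        case False
        then have a: "architecture ds'"
          using ds ds' by (cases ds') (auto simp: architecture_def Suc_le_eq)
        have "pnn r Vs y \<in> carrier_vec m"
          unfolding m_def by (rule pnn_carrier[OF a V(3)]) (use y ds' ds'_ne in simp)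
        then show ?thesis using weights_ne[OF a V(3)] by (simp add: w_def)
      qed
      have c: "V' \<in> carrier_mat n m" "V \<in> carrier_mat n m" using V by (simp_all add: V'_def m_def)
      show ?thesis
        unfolding V(1) eq mult_mat_vec_nth[OF c(1) w i] mult_mat_vec_nth[OF c(2) w i]
        using i by (simp add: V'_def sum_distrib_left mult.assoc)
    qed
    have "h (?join x u) = h (?join x' (Vs @ [V']))" if hin: "h \<in> net_values (ds @ [d]) r" for h
    proof -
      from vals[OF hin] obtain y k where y: "y \<in> carrier_vec (hd ds)" and k: "k < d"
        and h: "h = (\<lambda>Ws. pnn r Ws y $ k)" by blast
      have "x (k, i) * (pnn r u y $ i) ^ r = x' (k, i) * (pnn r (Vs @ [V']) y $ i) ^ r"
        if i: "i < n" for i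
        using nz[OF i] k i r by (simp add: last[OF y i] power_mult_distrib real_root_pow_pos x'_def)
      then show ?thesis unfolding h val[OF u y k] val[OF V'u y k] by simp
    qed
    with x's V'u show "\<exists>x'\<in>slab J (\<lambda>_. 1). \<exists>u'\<in>weights ds.
        \<forall>h\<in>net_values (ds @ [d]) r. h (?join x u) = h (?join x' u')"
      by (intro bexI[of _ x'] bexI[of _ "Vs @ [V']"] ballI)
  qed
  then show ?thesis unfolding cards .
qed

text \<open>The first entry of the minimum in \<open>edim\<close>. For positive widths it equals the
  number of weights minus the number of hidden neurons.\<close>

definition nparams :: "nat list \<Rightarrow> nat" where
  "nparams ds = last ds + (\<Sum>i<layers ds. ds ! i * ds ! Suc i - ds ! Suc i)"

lemma edim_eq: "edim ds r = min (nparams ds) (card (ambient_index ds r))"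
  by (simp add: edim_def nparams_def card_ambient_index)

lemma nparams_Cons: "ds \<noteq> [] \<Longrightarrow> nparams (d # ds) = nparams ds + (d * hd ds - hd ds)"
proof -
  assume ne: "ds \<noteq> []"
  then have l: "layers (d # ds) = Suc (layers ds)" by (cases ds) (simp_all add: layers_def)
  show ?thesis
    unfolding nparams_def l sum.lessThan_Suc_shift using ne by (simp add: hd_conv_nth)
qed

lemma nparams_snoc:
  assumes "ds \<noteq> []" "0 < last ds" "0 < d"
  shows "nparams (ds @ [d]) = nparams ds + (last ds * d - last ds)"
proof -
  obtain n where n: "length ds = Suc n" using assms(1) by (cases ds) auto
  have l: "layers (ds @ [d]) = Suc n" "layers ds = n" using n by (simp_all add: layers_def)
  have la: "last ds = ds ! n" using assms(1) n by (simp add: last_conv_nth)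
  have "(\<Sum>i<n. (ds @ [d]) ! i * (ds @ [d]) ! Suc i - (ds @ [d]) ! Suc i)
      = (\<Sum>i<n. ds ! i * ds ! Suc i - ds ! Suc i)"
    by (intro sum.cong refl) (simp add: nth_append n)
  then have "nparams (ds @ [d]) = d + ((\<Sum>i<n. ds ! i * ds ! Suc i - ds ! Suc i) + (ds ! n * d - d))"
    by (simp add: nparams_def l nth_append n)
  \<comment> \<open>Both sides equal \<open>ds ! n * d\<close>; positivity of both widths keeps the
    subtractions from truncating.\<close>
  moreover have "d + (ds ! n * d - d) = ds ! n + (ds ! n * d - ds ! n)"
    using assms(2,3) la by (simp add: Suc_le_eq)
  ultimately show ?thesis by (simp add: nparams_def l la)
qed

text \<open>Without hidden neurons nothing is normalised: all entries of the matrix are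
  free.\<close>

lemma growth_weights_single_layer:
  assumes "0 < a" "0 < b"
  shows "growth (weights [a, b]) (net_values [a, b] r) (a * b)"
proof -
  define J where "J = {..<b} \<times> {..<a}"
  have "growth (weights [a, b]) (net_values [a, b] r) (0 + card J)"
  proof (rule growth_join[where join = "\<lambda>x _. [mat b a x]" and N = "{}" and \<gamma> = "\<lambda>_. 0"
        and X = "{()}" and G = "{}" and e = 0 and e' = 1])
    show "growth {()} {} 0" by (rule growth_singleton)
    show "finite J" by (simp add: J_def)
    show "weights [a, b] = {[mat b a x] |x u. u \<in> {()}}" (is "_ = ?R")
    proof (intro equalityI subsetI)
      fix Ws assume Ws: "Ws \<in> weights [a, b]"
      then obtain V where V: "Ws = [V]" "V \<in> carrier_mat b a"
        by (auto simp: weights_def layers_def length_Suc_conv)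
      have "V = mat b a (\<lambda>ij. V $$ ij)" using V(2) by auto
      with V show "Ws \<in> ?R" by blast
    qed (auto simp: weights_def layers_def)
  next
    fix h :: "real mat list \<Rightarrow> real" assume "h \<in> net_values [a, b] r"
    then obtain y k where h: "h = (\<lambda>Ws. pnn r Ws y $ k)" and y: "y \<in> carrier_vec a" and k: "k < b"
      by (auto simp: net_values_def)
    have "polyfun UNIV vars 1 (\<lambda>x. \<Sum>j<a. y $ j * x (k, j))"
      by (intro polyfun_sum polyfun_scale polyfun_vars)
    then show "polyfun UNIV vars 1 (\<lambda>x. h [mat b a x])"
    proof (rule polyfun_cong)
      fix x :: "nat \<times> nat \<Rightarrow> real"
      have "(mat b a x *\<^sub>v y) $ k = (\<Sum>j<a. x (k, j) * y $ j)"
        by (subst mult_mat_vec_nth[OF _ y k]) (use k in auto)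
      then show "(\<Sum>j<a. y $ j * x (k, j)) = h [mat b a x]" by (simp add: h mult.commute)
    qed
  next
    fix x :: "nat \<times> nat \<Rightarrow> real"
    let ?x = "\<lambda>i. if i \<in> J then x i else 0"
    have "mat b a x = mat b a ?x" by (rule eq_matI) (auto simp: J_def)
    then show "\<exists>x'\<in>slab J (\<lambda>_. 0). \<exists>u'\<in>{()}.
        \<forall>h\<in>net_values [a, b] r. h [mat b a x] = h [mat b a x']"
      by (intro bexI[of _ ?x] bexI[of _ "()"] ballI) (auto simp: slab_def)
  qed (simp_all add: polyfun_const)
  then show ?thesis by (simp add: J_def card_cartesian_product mult.commute)
qed

text \<open>Layers are prepended to the single output matrix. The result gives the parameter half of
  \<open>dim \<le> edim\<close> and shows that a least order of growth exists.\<close>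

lemma growth_nparams:
  assumes "architecture ds"
  shows "growth (weights ds) (net_values ds r) (nparams ds)"
  using assms
proof (induction ds)
  case Nil
  then show ?case by (simp add: architecture_def)
next
  case (Cons d ds)
  then have ne: "ds \<noteq> []" and d: "0 < d" by (auto simp: architecture_def)
  show ?case
  proof (cases "length ds = 1")
    case True
    then obtain b where b: "ds = [b]" by (auto simp: length_Suc_conv)
    have "0 < b" using Cons.prems b by (simp add: architecture_def)
    then have "nparams (d # ds) = d * b" using b d by (simp add: nparams_def layers_def)
    with growth_weights_single_layer[OF d \<open>0 < b\<close>] b show ?thesis by simp
  next
    case False
    then have "architecture ds" using Cons.prems ne by (cases ds) (auto simp: architecture_def Suc_le_eq)
    from growth_weights_Cons[OF this d Cons.IH[OF this]] show ?thesis
      using nparams_Cons[OF ne] by simp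
  qed
qed

text \<open>The same \<open>k\<close> is added to the order and to \<open>nparams\<close>, so a gap
  between them persists.\<close>

lemma growth_weights_append_left:
  assumes "architecture ds" "\<forall>d\<in>set pre. 0 < d" "growth (weights ds) (net_values ds r) s"
  shows "\<exists>k. growth (weights (pre @ ds)) (net_values (pre @ ds) r) (s + k) \<and>
    nparams (pre @ ds) = nparams ds + k \<and> architecture (pre @ ds)"
  using assms(2)
proof (induction pre)
  case Nil
  show ?case by (rule exI[of _ 0]) (use assms in simp)
next
  case (Cons d pre)
  then obtain k where k: "growth (weights (pre @ ds)) (net_values (pre @ ds) r) (s + k)"
    "nparams (pre @ ds) = nparams ds + k" "architecture (pre @ ds)" by auto
  have d: "0 < d" using Cons.prems by simp
  have ne: "pre @ ds \<noteq> []" using architecture_pos[OF k(3)] by simp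
  show ?case
    using growth_weights_Cons[OF k(3) d k(1)] nparams_Cons[OF ne, of d] k(2)
      architecture_Cons[OF k(3) d]
    by (intro exI[of _ "k + (d * hd (pre @ ds) - hd (pre @ ds))"]) (simp add: add.assoc)
qed

lemma growth_weights_append_right:
  assumes "0 < r" "architecture ds" "\<forall>d\<in>set post. 0 < d" "growth (weights ds) (net_values ds r) s"
  shows "\<exists>k. growth (weights (ds @ post)) (net_values (ds @ post) r) (s + k) \<and>
    nparams (ds @ post) = nparams ds + k \<and> architecture (ds @ post)"
  using assms(3)
proof (induction post rule: rev_induct)
  case Nil
  show ?case by (rule exI[of _ 0]) (use assms in simp)
next
  case (snoc d post)
  then obtain k where k: "growth (weights (ds @ post)) (net_values (ds @ post) r) (s + k)"
    "nparams (ds @ post) = nparams ds + k" "architecture (ds @ post)" by auto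
  have d: "0 < d" using snoc.prems by simp
  have pos: "ds @ post \<noteq> []" "0 < last (ds @ post)" using architecture_pos[OF k(3)] by auto
  show ?case
    using growth_weights_snoc[OF assms(1) k(3) d k(1)] nparams_snoc[OF pos d] k(2)
      architecture_snoc[OF k(3) d]
    by (intro exI[of _ "k + (last (ds @ post) * d - last (ds @ post))"]) (simp add: add.assoc)
qed

section \<open>Dimension and defect of neurovarieties\<close>

definition weight_index :: "nat list \<Rightarrow> (nat \<times> nat \<times> nat) set" where
  "weight_index ds = (SIGMA l:{..<layers ds}. {..<ds ! Suc l} \<times> {..<ds ! l})"

text \<open>Flattens all weights into one family of real variables, so that slicing can fix them one
  at a time.\<close>

definition weights_of :: "nat list \<Rightarrow> (nat \<times> nat \<times> nat \<Rightarrow> real) \<Rightarrow> real mat list" where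
  "weights_of ds x = map (\<lambda>l. mat (ds ! Suc l) (ds ! l) (\<lambda>(i, j). x (l, i, j))) [0..<layers ds]"

lemma weights_of_in: "weights_of ds x \<in> weights ds"
  by (simp add: weights_def weights_of_def)

lemma weights_of_nth:
  "l < layers ds \<Longrightarrow> i < ds ! Suc l \<Longrightarrow> j < ds ! l \<Longrightarrow> (weights_of ds x ! l) $$ (i, j) = x (l, i, j)"
  by (simp add: weights_of_def)

lemma weights_eq_image: "weights ds = weights_of ds ` slab (weight_index ds) (\<lambda>_. 0)"
proof (intro equalityI subsetI)
  fix Ws assume Ws: "Ws \<in> weights ds"
  define x where "x = (\<lambda>(l, i, j). if (l, i, j) \<in> weight_index ds then (Ws ! l) $$ (i, j) else 0)"
  have "Ws = weights_of ds x"
  proof (rule nth_equalityI)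
    show "length Ws = length (weights_of ds x)" using Ws by (simp add: weights_def weights_of_def)
    fix l assume "l < length Ws"
    then have l: "l < layers ds" "Ws ! l \<in> carrier_mat (ds ! Suc l) (ds ! l)"
      using Ws by (auto simp: weights_def)
    show "Ws ! l = weights_of ds x ! l"
      by (rule eq_matI) (use l in \<open>auto simp: weights_of_def x_def weight_index_def\<close>)
  qed
  moreover have "x \<in> slab (weight_index ds) (\<lambda>_. 0)" by (auto simp: slab_def x_def)
  ultimately show "Ws \<in> weights_of ds ` slab (weight_index ds) (\<lambda>_. 0)" by blast
qed (auto simp: weights_of_in)

lemma polyfun_coeffs_weights_of:
  assumes ds: "architecture ds"
  shows "\<exists>e. \<forall>i. polyfun UNIV vars e (\<lambda>x. coords (param_map ds r (weights_of ds x)) i)"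
proof -
  obtain E where E: "\<And>Ms v k.
    \<forall>\<theta>\<in>UNIV. Ms \<theta> \<in> weights ds \<and> v \<theta> \<in> carrier_vec (hd ds) \<Longrightarrow>
    \<forall>l i j. l < layers ds \<longrightarrow> i < ds ! Suc l \<longrightarrow> j < ds ! l \<longrightarrow>
      polyfun UNIV (vars :: ((nat \<times> nat \<times> nat \<Rightarrow> real) \<Rightarrow> real) set) 1 (\<lambda>\<theta>. (Ms \<theta> ! l) $$ (i, j)) \<Longrightarrow>
    \<forall>i<hd ds. polyfun UNIV vars 0 (\<lambda>\<theta>. v \<theta> $ i) \<Longrightarrow> k < last ds \<Longrightarrow>
    polyfun UNIV vars E (\<lambda>\<theta>. pnn r (Ms \<theta>) (v \<theta>) $ k)"
    using pnn_polyfun[OF ds, of UNIV vars 0 r] by blast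
  have val: "polyfun UNIV vars E (\<lambda>x. h (weights_of ds x))" if "h \<in> net_values ds r" for h
  proof -
    from that obtain y k where h: "h = (\<lambda>Ws. pnn r Ws y $ k)" and y: "y \<in> carrier_vec (hd ds)"
      and k: "k < last ds" by (auto simp: net_values_def)
    show ?thesis
      unfolding h
      by (rule E) (use y k in \<open>simp_all add: weights_of_in polyfun_const weights_of_nth polyfun_vars[simplified]\<close>)
  qed
  have "polyfun UNIV vars (1 * E) (\<lambda>x. coords (param_map ds r (weights_of ds x)) (k, m))" for k m
    by (rule polyfun_comp[where \<phi> = "weights_of ds", OF coeffs_polyfun_net_values[OF ds] weights_of_in])
      (rule val)
  then show ?thesis by auto
qed

lemma closedin_neurovariety: "closedin (zariski (ambient ds r) coords) (neurovariety ds r)"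
  by (simp add: neurovariety_def)

lemma neurodim_eq:
  "neurodim ds r = Sup {enat n | n. \<exists>Y. irr_chain (zariski (ambient ds r) coords) n Y \<and>
    Y n \<subseteq> neurovariety ds r}"
  unfolding neurodim_def krull_dim_irr_chain irr_chain_subtopology[OF closedin_neurovariety] ..

lemma irr_chain_le_growth_weights:
  assumes ds: "architecture ds" and gr: "growth (weights ds) (net_values ds r) s"
    and "irr_chain (zariski (ambient ds r) coords) n Y" "Y n \<subseteq> neurovariety ds r"
  shows "n \<le> s"
  using assms(3,4) param_map_in_ambient[OF ds] gr growth_values_iff_coeffs[OF ds]
  by (intro irr_chain_length_le_growth[where f = "param_map ds r" and X = "weights ds"])
    (auto simp: neurovariety_def)

text \<open>Makes the inequality in \<open>defective\<close> strict in the right direction.\<close>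

lemma neurodim_le_edim:
  assumes "architecture ds"
  shows "neurodim ds r \<le> enat (edim ds r)"
  unfolding neurodim_eq edim_eq
  using irr_chain_le_growth_weights[OF assms growth_nparams[OF assms]] irr_chain_le_ambient
  by (intro Sup_least) fastforce

text \<open>The least order works: no smaller one is available, so slicing yields a chain of that
  length ending in the neurovariety.\<close>

lemma ex_growth_le_neurodim:
  assumes ds: "architecture ds"
  shows "\<exists>s. growth (weights ds) (net_values ds r) s \<and> enat s \<le> neurodim ds r"
proof -
  let ?G = "coord_funs (\<lambda>Ws. coords (param_map ds r Ws))"
  define s where "s = (LEAST s. growth (weights ds) ?G s)"
  have gr: "growth (weights ds) ?G s"
    unfolding s_def using growth_nparams[OF ds] growth_values_iff_coeffs[OF ds] by (metis LeastI)
  let ?f = "\<lambda>x. param_map ds r (weights_of ds x)"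
  let ?B = "slab (weight_index ds) (\<lambda>_. 0)"
  obtain e where e: "\<And>i. polyfun UNIV vars e (\<lambda>x. coords (?f x) i)"
    using polyfun_coeffs_weights_of[OF ds] by blast
  have "\<exists>Y. irr_chain (zariski (ambient ds r) coords) s Y \<and>
      Y s = zclosure (ambient ds r) coords (?f ` ?B)"
  proof (rule irr_chain_of_not_growth[where f = ?f, OF _ _ e])
    show "finite (weight_index ds)" by (simp add: weight_index_def)
    show "range ?f \<subseteq> ambient ds r"
      using param_map_in_ambient[OF ds weights_of_in] by auto
    fix t assume "t < s"
    show "\<not> growth ?B (coord_funs (\<lambda>x. coords (?f x))) t"
    proof
      assume "growth ?B (coord_funs (\<lambda>x. coords (?f x))) t"
      then have "growth (weights ds) ?G t"
        by (rule growth_comp[where e = 1, OF _ weights_eq_image[symmetric]])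
          (auto simp: coord_funs_def intro!: polyfun_gen)
      then show False using \<open>t < s\<close> not_less_Least unfolding s_def by blast
    qed
  qed
  moreover have "?f ` ?B = param_map ds r ` weights ds"
    by (simp add: weights_eq_image image_image)
  ultimately have "enat s \<le> neurodim ds r"
    unfolding neurodim_eq neurovariety_def by (intro Sup_upper) auto
  with gr show ?thesis using growth_values_iff_coeffs[OF ds] by blast
qed

theorem corollary5p9:
  fixes r :: nat and pre ds post :: "nat list"
  assumes "0 < r"
    and "architecture ds"
    and "defective ds r"
    and "architecture (pre @ ds @ post)"
    and "\<not> filling (pre @ ds @ post) r"
  shows "defective (pre @ ds @ post) r"
proof -
  let ?ds = "pre @ ds @ post"
  let ?T = "zariski (ambient ?ds r) coords" and ?V = "neurovariety ?ds r"
  obtain s where s: "growth (weights ds) (net_values ds r) s" "enat s \<le> neurodim ds r"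
    using ex_growth_le_neurodim[OF assms(2)] by blast
  have "neurodim ds r < enat (edim ds r)"
    using neurodim_le_edim[OF assms(2), of r] assms(3) by (simp add: defective_def)
  then have "enat s < enat (edim ds r)" using s(2) by (rule le_less_trans[rotated])
  \<comment> \<open>Being below the minimum \<open>edim\<close> means in particular being below
    \<open>nparams\<close>, and this part of the gap is passed on to the extension.\<close>
  then have less: "s < nparams ds" by (simp add: edim_eq)
  have pos: "\<forall>d\<in>set pre. 0 < d" "\<forall>d\<in>set post. 0 < d"
    using assms(4) by (auto simp: architecture_def)
  obtain k where k: "growth (weights (ds @ post)) (net_values (ds @ post) r) (s + k)"
    "nparams (ds @ post) = nparams ds + k" "architecture (ds @ post)"
    using growth_weights_append_right[OF assms(1,2) pos(2) s(1)] by blast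
  obtain l where l: "growth (weights ?ds) (net_values ?ds r) (s + k + l)"
    "nparams ?ds = nparams (ds @ post) + l"
    using growth_weights_append_left[OF k(3) pos(1) k(1)] by blast
  have "n < edim ?ds r" if Y: "irr_chain ?T n Y" "Y n \<subseteq> ?V" for n Y
  proof -
    have "n \<le> s + k + l" by (rule irr_chain_le_growth_weights[OF assms(4) l(1) Y])
    then have "n < nparams ?ds" using less k(2) l(2) by simp
    \<comment> \<open>Since the neurovariety is a proper subset, the ambient space can be put on top
      of the chain, and the longer chain still obeys the ambient bound.\<close>
    moreover have "n < card (ambient_index ?ds r)"
    proof -
      have "?V \<subseteq> ambient ?ds r"
        using closedin_subset[OF closedin_neurovariety[of ?ds r]] by simp
      then have "Y n \<subset> ambient ?ds r" using assms(5) Y(2) by (auto simp: filling_def)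
      moreover have "closedin ?T (ambient ?ds r)"
        using closedin_topspace[of ?T] by simp
      ultimately have "irr_chain ?T (Suc n) (Y(Suc n := ambient ?ds r))"
        using irr_chain_append[OF Y(1) _ irreducible_ambient] by blast
      from irr_chain_le_ambient[OF this] show ?thesis by simp
    qed
    ultimately show ?thesis by (simp add: edim_eq)
  qed
  \<comment> \<open>A supremum need not inherit strict bounds on its members, so they are replaced
    by the non-strict bound \<open>edim - 1\<close>.\<close>
  then have "n \<le> edim ?ds r - 1 \<and> 0 < edim ?ds r" if "irr_chain ?T n Y" "Y n \<subseteq> ?V" for n Y
    using that by fastforce
  then have "neurodim ?ds r \<le> enat (edim ?ds r - 1)"
    unfolding neurodim_eq by (intro Sup_least) auto
  \<comment> \<open>Otherwise the truncated \<open>edim - 1\<close> would equal \<open>edim\<close>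
    and the last bound would not be strict.\<close>
  moreover have "0 < edim ?ds r"
  proof -
    have "0 < hd ?ds" "0 < last ?ds" using architecture_pos[OF assms(4)] by auto
    then have "0 < card (ambient_index ?ds r)"
      unfolding card_ambient_index by (simp add: zero_less_binomial_iff)
    then show ?thesis using less k(2) l(2) by (simp add: edim_eq)
  qed
  ultimately show ?thesis
    by (cases "neurodim ?ds r") (auto simp: defective_def)
qed

end
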